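(* Let $\psi:\mathfrak n^+\to\mathbb C$ be a Lie algebra homomorphism with $\psi(d_1)\neq0$ and $\psi(d_2)\neq0$. Assume that $V$ is a Whittaker module of type $\psi$ for $\mathcal V$ with cyclic Whittaker vector $w$, and suppose that $\mathrm{Ann}_{S(z)}(w)\neq 0$. Let $p(z)$ be the unique monic generator of the ideal $\mathrm{Ann}_{S(z)}(w)$ in $S(z)$, and write $p(z)=\prod_{i=1}^k(z-\xi_i1)^{a_i}$ for distinct $\xi_1,\dots,\xi_k\in\mathbb C$ and positive integers $a_1,\dots,a_k$. For $1\le j\le k$ define $$p_j(z)=\prod_{i\neq j}(z-\xi_i1)^{a_i},\qquad w_j=p_j(z)w,\qquad V_j=U(\mathcal V)w_j .$$ Then each $V_j$ is a Whittaker module of type $\psi$ with cyclic Whittaker vector $w_j$, and $V=V_1\oplus\cdots\oplus V_k$. Furthermore, the submodules $V_1,\dots,V_k$ are indecomposable; $V_j$ is simple if and only if $a_j=1$; and $a_j$ is the composition length of $V_j$.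
   Context: The Virasoro algebra is the complex Lie algebra $\mathcal V$ with basis $\{z\}\cup\{d_k : k\in\mathbb Z\}$ and bracket $[d_k,d_j]=(j-k)d_{k+j}+\delta_{j,-k}\frac{k^3-k}{12}z$, $[z,d_k]=0$. Let $\mathfrak n^+=\mathrm{span}_{\mathbb C}\{d_1,d_2,\dots\}$, and let $S(z)=\mathbb C[z]\subseteq U(\mathcal V)$ be the polynomial algebra in the central element $z$. For a $\mathcal V$-module $V$, a vector $w\in V$ is a Whittaker vector (of type $\psi$) if $xw=\psi(x)w$ for all $x\in\mathfrak n^+$; $V$ is a Whittaker module of type $\psi$ if it is generated as a $\mathcal V$-module by a Whittaker vector $w$ of type $\psi$, and such a $w$ is called a cyclic Whittaker vector. $\mathrm{Ann}_{S(z)}(w)=\{q\in S(z): qw=0\}$. *)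

theory Defs
  imports
    Complex_Main
    "HOL-Library.Poly_Mapping"
    "HOL-Computational_Algebra.Polynomial"
begin

text \<open>
  The Virasoro algebra, as the complex vector space of finitely supported functions on its
  basis \<open>{z} \<union> {d\<^sub>k | k \<in> \<int>}\<close>.
\<close>

datatype vir_basis = Z | D int

type_synonym virasoro = "vir_basis \<Rightarrow>\<^sub>0 complex"

definition vscale :: "complex \<Rightarrow> virasoro \<Rightarrow> virasoro" where
  "vscale c x = Poly_Mapping.map ((*) c) x"

definition vir_z :: virasoro where
  "vir_z = Poly_Mapping.single Z 1"

definition vir_d :: "int \<Rightarrow> virasoro" where
  "vir_d k = Poly_Mapping.single (D k) 1"

lemma lookup_vscale [simp]: "Poly_Mapping.lookup (vscale c x) b = c * Poly_Mapping.lookup x b"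
  by (simp add: vscale_def Poly_Mapping.map.rep_eq when_def)

interpretation vir: vector_space vscale
  by standard (auto intro!: poly_mapping_eqI simp: lookup_add algebra_simps)

fun basis_bracket :: "vir_basis \<Rightarrow> vir_basis \<Rightarrow> virasoro" where
  "basis_bracket (D k) (D j) =
     vscale (of_int (j - k)) (vir_d (k + j)) +
     (if j = - k then vscale ((of_int k ^ 3 - of_int k) / 12) vir_z else 0)"
| "basis_bracket Z b = 0"
| "basis_bracket b Z = 0"

definition bracket :: "virasoro \<Rightarrow> virasoro \<Rightarrow> virasoro" where
  "bracket x y = (\<Sum>a \<in> Poly_Mapping.keys x. \<Sum>b \<in> Poly_Mapping.keys y.
     vscale (Poly_Mapping.lookup x a * Poly_Mapping.lookup y b) (basis_bracket a b))"

lemma bracket_superset: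
  assumes "finite A" "Poly_Mapping.keys x \<subseteq> A" "finite B" "Poly_Mapping.keys y \<subseteq> B"
  shows "bracket x y = (\<Sum>a\<in>A. \<Sum>b\<in>B.
    vscale (Poly_Mapping.lookup x a * Poly_Mapping.lookup y b) (basis_bracket a b))"
proof -
  have "(\<Sum>b \<in> Poly_Mapping.keys y.
       vscale (Poly_Mapping.lookup x a * Poly_Mapping.lookup y b) (basis_bracket a b)) =
     (\<Sum>b\<in>B. vscale (Poly_Mapping.lookup x a * Poly_Mapping.lookup y b) (basis_bracket a b))" for a
    by (rule sum.mono_neutral_left) (use assms in \<open>auto simp: in_keys_iff\<close>)
  moreover have "(\<Sum>a \<in> Poly_Mapping.keys x. \<Sum>b\<in>B.
       vscale (Poly_Mapping.lookup x a * Poly_Mapping.lookup y b) (basis_bracket a b)) =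
     (\<Sum>a\<in>A. \<Sum>b\<in>B. vscale (Poly_Mapping.lookup x a * Poly_Mapping.lookup y b) (basis_bracket a b))"
    by (rule sum.mono_neutral_left) (use assms in \<open>auto simp: in_keys_iff\<close>)
  ultimately show ?thesis by (simp add: bracket_def)
qed

lemma bracket_add_left: "bracket (x + x') y = bracket x y + bracket x' y"
proof -
  let ?A = "Poly_Mapping.keys x \<union> Poly_Mapping.keys x'" and ?B = "Poly_Mapping.keys y"
  have "Poly_Mapping.keys (x + x') \<subseteq> ?A" by (rule keys_add)
  then show ?thesis
    by (simp add: bracket_superset[of ?A _ ?B] lookup_add distrib_right vir.scale_left_distrib
        sum.distrib)
qed

lemma bracket_scale_left: "bracket (vscale c x) y = vscale c (bracket x y)"
proof -
  have "Poly_Mapping.keys (vscale c x) \<subseteq> Poly_Mapping.keys x"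
    by (auto simp: in_keys_iff)
  then show ?thesis
    by (simp add: bracket_superset[of "Poly_Mapping.keys x" _ "Poly_Mapping.keys y"]
        vir.scale_sum_right mult.assoc)
qed

lemma basis_bracket_skew: "basis_bracket b a = - basis_bracket a b"
proof (cases a; cases b)
  fix k j assume "a = D k" "b = D j"
  moreover have "vscale ((of_int k ^ 3 - of_int k) / 12) vir_z =
      - vscale ((of_int j ^ 3 - of_int j) / 12) vir_z" if "j = - k"
  proof -
    have "(of_int k ^ 3 - of_int k) / 12 = - ((of_int j ^ 3 - of_int j) / 12 :: complex)"
      using that by (simp add: field_simps)
    then show ?thesis by (metis vir.scale_minus_left)
  qed
  moreover have "vscale (of_int (k - j)) (vir_d (j + k)) = - vscale (of_int (j - k)) (vir_d (k + j))"
    by (metis add.commute minus_diff_eq of_int_minus vir.scale_minus_left)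
  ultimately show ?thesis by auto
qed auto

lemma bracket_skew: "bracket y x = - bracket x y"
proof -
  have "bracket y x = (\<Sum>a \<in> Poly_Mapping.keys x. \<Sum>b \<in> Poly_Mapping.keys y.
      vscale (Poly_Mapping.lookup y b * Poly_Mapping.lookup x a) (basis_bracket b a))"
    unfolding bracket_def by (rule sum.swap)
  also have "\<dots> = - bracket x y"
    unfolding bracket_def sum_negf[symmetric]
    by (intro sum.cong refl) (metis basis_bracket_skew mult.commute vir.scale_minus_right)
  finally show ?thesis .
qed

lemma bracket_add_right: "bracket x (y + y') = bracket x y + bracket x y'"
  by (metis bracket_add_left bracket_skew minus_add_distrib)

lemma bracket_scale_right: "bracket x (vscale c y) = vscale c (bracket x y)"
  by (metis bracket_scale_left bracket_skew vir.scale_minus_right)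

lemma bracket_basis:
  "bracket (Poly_Mapping.single a 1) (Poly_Mapping.single b 1) = basis_bracket a b"
  by (simp add: bracket_def)

lemma bracket_d_d:
  "bracket (vir_d k) (vir_d j) = vscale (of_int (j - k)) (vir_d (k + j)) +
     (if j = - k then vscale ((of_int k ^ 3 - of_int k) / 12) vir_z else 0)"
  by (simp only: vir_d_def[of k] vir_d_def[of j] bracket_basis basis_bracket.simps)

lemma bracket_z: "bracket vir_z x = 0" "bracket x vir_z = 0"
proof -
  show *: "bracket vir_z x = 0" by (simp add: bracket_def vir_z_def)
  show "bracket x vir_z = 0" using bracket_skew[of x vir_z] * by simp
qed

lemma vir_basis_induct:
  assumes "P 0" "\<And>x y. P x \<Longrightarrow> P y \<Longrightarrow> P (x + y)" "\<And>c x. P x \<Longrightarrow> P (vscale c x)"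
    "P vir_z" "\<And>k. P (vir_d k)"
  shows "P x"
proof -
  have s: "P (Poly_Mapping.single b 1)" for b
    using assms(4,5) by (cases b) (auto simp: vir_z_def vir_d_def)
  have "P (\<Sum>b\<in>A. vscale (Poly_Mapping.lookup x b) (Poly_Mapping.single b 1))" if "finite A" for A
    using that by (induction A) (auto intro: assms(1-3) s)
  moreover have "(\<Sum>b\<in>Poly_Mapping.keys x.
      vscale (Poly_Mapping.lookup x b) (Poly_Mapping.single b 1)) = x"
    by (rule poly_mapping_eqI)
      (auto simp: lookup_sum lookup_single when_def in_keys_iff if_distrib cong: if_cong)
  ultimately show ?thesis by (metis finite_keys)
qed

lemma bracket_zero: "bracket 0 x = 0" "bracket x 0 = 0"
  by (simp_all add: bracket_def)

lemma bracket_d_d_d: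
  "bracket (vir_d k) (bracket (vir_d j) (vir_d m)) =
     vscale (of_int ((m - j) * (j + m - k))) (vir_d (k + j + m)) +
     vscale (if k + j + m = 0 then of_int (m - j) * (of_int k ^ 3 - of_int k) / 12 else 0) vir_z"
proof -
  have "bracket (vir_d k) (bracket (vir_d j) (vir_d m)) =
      vscale (of_int (m - j)) (bracket (vir_d k) (vir_d (j + m)))"
    by (simp add: bracket_d_d[of j m] bracket_add_right bracket_scale_right bracket_z bracket_zero)
  moreover have "j + m = - k \<longleftrightarrow> k + j + m = 0" by linarith
  ultimately show ?thesis
    by (simp add: bracket_d_d vir.scale_right_distrib add.assoc)
qed

lemma jacobi:
  "bracket x (bracket y u) + bracket y (bracket u x) + bracket u (bracket x y) = 0"
proof -
  let ?J = "\<lambda>x y u. bracket x (bracket y u) + bracket y (bracket u x) + bracket u (bracket x y)"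
  have add: "?J (x + x') y u = ?J x y u + ?J x' y u" for x x' y u
    by (simp add: bracket_add_left bracket_add_right algebra_simps)
  have scale: "?J (vscale c x) y u = vscale c (?J x y u)" for c x y u
    by (simp add: bracket_scale_left bracket_scale_right vir.scale_right_distrib)
  have cyc: "?J x y u = ?J y u x" for x y u by (simp add: ac_simps)
  have z: "?J vir_z y u = 0" for y u by (simp add: bracket_z bracket_zero)
  have ddd: "?J (vir_d k) (vir_d j) (vir_d m) = 0" for k j m
  proof -
    have s: "j + m + k = k + j + m" "m + k + j = k + j + m" by simp_all
    have c: "(if k + j + m = 0 then of_int (m - j) * (of_int k ^ 3 - of_int k) / 12 else 0) +
        (if k + j + m = 0 then of_int (k - m) * (of_int j ^ 3 - of_int j) / 12 else 0) +
        (if k + j + m = 0 then of_int (j - k) * (of_int m ^ 3 - of_int m) / 12 else 0) = (0 :: complex)"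
    proof (cases "k + j + m = 0")
      case True
      then have "k = - j - m" by linarith
      show ?thesis unfolding \<open>k = - j - m\<close> by (simp add: field_simps power3_eq_cube)
    qed simp
    have d: "of_int ((m - j) * (j + m - k)) + of_int ((k - m) * (m + k - j)) +
        of_int ((j - k) * (k + j - m)) = (0 :: complex)"
      by (simp add: algebra_simps)
    have "vscale p1 v + vscale q1 u + (vscale p2 v + vscale q2 u) + (vscale p3 v + vscale q3 u) =
        vscale (p1 + p2 + p3) v + vscale (q1 + q2 + q3) u" for p1 p2 p3 q1 q2 q3 u v
      by (simp add: vir.scale_left_distrib)
    then show ?thesis
      unfolding bracket_d_d_d s by (simp only: c d vir.scale_zero_left add_0)
  qed
  have ind: "?J x y u = 0" if "\<And>k. ?J (vir_d k) y u = 0" for x y u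
  proof (induction x rule: vir_basis_induct)
    case 1
    show ?case by (simp add: bracket_zero)
  next
    case (2 x x')
    then show ?case using add[of x x' y u] by simp
  next
    case (3 c x)
    then show ?case using scale[of c x y u] by simp
  next
    case 4
    show ?case by (rule z)
  next
    case (5 k)
    show ?case by (rule that)
  qed
  have 1: "?J x (vir_d j) (vir_d m) = 0" for x j m
    using ddd by (rule ind)
  have 2: "?J y (vir_d m) x = 0" for x y m
    by (rule ind) (use 1[of x] cyc in metis)
  show ?thesis
    by (rule ind) (use 2[of y _ u] cyc 2 in metis)
qed

definition n_plus :: "virasoro set" where
  "n_plus = vir.span (vir_d ` {k. k \<ge> 1})"

text \<open>
  Lie algebra homomorphisms from \<open>n_plus\<close> to the one-dimensional Lie algebra of complex numbers,
  whose bracket is the (vanishing) commutator. Values outside \<open>n_plus\<close> are irrelevant.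
\<close>

definition lie_hom_n_plus :: "(virasoro \<Rightarrow> complex) \<Rightarrow> bool" where
  "lie_hom_n_plus \<psi> \<longleftrightarrow>
     (\<forall>x\<in>n_plus. \<forall>y\<in>n_plus. \<psi> (x + y) = \<psi> x + \<psi> y) \<and>
     (\<forall>c. \<forall>x\<in>n_plus. \<psi> (vscale c x) = c * \<psi> x) \<and>
     (\<forall>x\<in>n_plus. \<forall>y\<in>n_plus. \<psi> (bracket x y) = \<psi> x * \<psi> y - \<psi> y * \<psi> x)"

text \<open>
  \<open>q\<close> is the monic generator of the ideal \<open>I\<close>; it is unique, since two monic polynomials dividing
  each other are equal.
\<close>

definition monic_generator :: "'a::field poly \<Rightarrow> 'a poly set \<Rightarrow> bool" where
  "monic_generator q I \<longleftrightarrow> lead_coeff q = 1 \<and> I = {r. q dvd r}"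

locale virasoro_module = vector_space scale
  for scale :: "complex \<Rightarrow> 'v::ab_group_add \<Rightarrow> 'v" +
  fixes act :: "virasoro \<Rightarrow> 'v \<Rightarrow> 'v"
  assumes linear_act_left: "Vector_Spaces.linear vscale scale (\<lambda>x. act x v)"
    and linear_act_right: "Vector_Spaces.linear scale scale (act x)"
    and act_bracket: "act (bracket x y) v = act x (act y v) - act y (act x v)"
begin

definition submodule :: "'v set \<Rightarrow> bool" where
  "submodule N \<longleftrightarrow> subspace N \<and> (\<forall>x. \<forall>v\<in>N. act x v \<in> N)"

text \<open>
  The submodule generated by \<open>v\<close>, that is \<open>U v\<close> for the universal enveloping algebra \<open>U\<close>:
  as a vector space \<open>U\<close> is spanned by the products \<open>x\<^sub>1 \<cdots> x\<^sub>n\<close> (\<open>n \<ge> 0\<close>) of elements of the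
  Lie algebra, and such a product sends \<open>v\<close> to \<open>x\<^sub>1 (\<cdots> (x\<^sub>n v))\<close>.
\<close>

definition gen :: "'v \<Rightarrow> 'v set" where
  "gen v = span {foldr act xs v |xs. True}"

text \<open>The action of a polynomial in the central element \<open>z\<close>, and annihilators therein.\<close>

definition zpoly :: "complex poly \<Rightarrow> 'v \<Rightarrow> 'v" where
  "zpoly q v = (\<Sum>i\<le>degree q. scale (coeff q i) ((act vir_z ^^ i) v))"

definition z_ann :: "'v \<Rightarrow> complex poly set" where
  "z_ann v = {q. zpoly q v = 0}"

definition whittaker_vector :: "(virasoro \<Rightarrow> complex) \<Rightarrow> 'v \<Rightarrow> bool" where
  "whittaker_vector \<psi> v \<longleftrightarrow> (\<forall>x\<in>n_plus. act x v = scale (\<psi> x) v)"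

text \<open>\<open>M\<close> is a Whittaker module of type \<open>\<psi>\<close> with cyclic Whittaker vector \<open>v\<close>.\<close>

definition whittaker_module :: "(virasoro \<Rightarrow> complex) \<Rightarrow> 'v set \<Rightarrow> 'v \<Rightarrow> bool" where
  "whittaker_module \<psi> M v \<longleftrightarrow>
     submodule M \<and> v \<in> M \<and> whittaker_vector \<psi> v \<and> gen v = M"

text \<open>\<open>M\<close> is the internal direct sum of the finite family of submodules \<open>N\<close>.\<close>

definition direct_sum :: "'v set \<Rightarrow> 'i set \<Rightarrow> ('i \<Rightarrow> 'v set) \<Rightarrow> bool" where
  "direct_sum M I N \<longleftrightarrow>
     finite I \<and> (\<forall>i\<in>I. submodule (N i)) \<and>
     M = {sum f I |f. \<forall>i\<in>I. f i \<in> N i} \<and>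
     (\<forall>f. (\<forall>i\<in>I. f i \<in> N i) \<and> sum f I = 0 \<longrightarrow> (\<forall>i\<in>I. f i = 0))"

definition indecomposable :: "'v set \<Rightarrow> bool" where
  "indecomposable M \<longleftrightarrow>
     submodule M \<and> M \<noteq> {0} \<and>
     \<not> (\<exists>A B. submodule A \<and> submodule B \<and> A \<noteq> {0} \<and> B \<noteq> {0} \<and>
          A \<inter> B = {0} \<and> M = {a + b |a b. a \<in> A \<and> b \<in> B})"

definition simple :: "'v set \<Rightarrow> bool" where
  "simple M \<longleftrightarrow>
     submodule M \<and> M \<noteq> {0} \<and> (\<forall>N. submodule N \<and> N \<subseteq> M \<longrightarrow> N = {0} \<or> N = M)"

text \<open>
  Composition series \<open>{0} = F 0 \<subset> F 1 \<subset> \<dots> \<subset> F n = M\<close>: each \<open>F i\<close> is a maximal proper submodule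
  of \<open>F (i + 1)\<close>, so that the quotients are simple. The second conjunct of
  \<open>composition_length\<close> records that the length does not depend on the series.
\<close>

definition composition_series :: "'v set \<Rightarrow> nat \<Rightarrow> (nat \<Rightarrow> 'v set) \<Rightarrow> bool" where
  "composition_series M n F \<longleftrightarrow>
     F 0 = {0} \<and> F n = M \<and> (\<forall>i\<le>n. submodule (F i)) \<and>
     (\<forall>i<n. F i \<subset> F (Suc i) \<and>
        (\<forall>N. submodule N \<and> F i \<subseteq> N \<and> N \<subseteq> F (Suc i) \<longrightarrow> N = F i \<or> N = F (Suc i)))"

definition composition_length :: "'v set \<Rightarrow> nat \<Rightarrow> bool" where
  "composition_length M n \<longleftrightarrow>
     (\<exists>F. composition_series M n F) \<and> (\<forall>m F. composition_series M m F \<longrightarrow> m = n)"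

end

end

theory Submission
  imports
    Defs
    "HOL-Library.Multiset"
    "HOL-Computational_Algebra.Polynomial_Factorial"
    "HOL-Computational_Algebra.Field_as_Ring"
begin

text \<open>
  Write \<open>E\<^sub>n = d\<^sub>n - \<psi>(d\<^sub>n)\<close> for \<open>n \<ge> 1\<close>; the operators \<open>E\<^sub>n\<close> kill \<open>q(z) w\<close> for every polynomial \<open>q\<close>.
  The theorem rests on one fact about arbitrary submodules \<open>N\<close> of \<open>V\<close>: if
  \<open>\<Sum>\<^sub>\<lambda> d\<^sub>-\<^sub>\<lambda> q\<^sub>\<lambda>(z) w\<close> lies in \<open>N\<close>, where \<open>\<lambda>\<close> runs over finitely many multisets of natural numbers
  and \<open>d\<^sub>-\<^sub>\<lambda>\<close> is the product of the \<open>d\<^sub>-\<^sub>k\<close> with \<open>k \<in> \<lambda>\<close>, then each \<open>q\<^sub>\<lambda>(z) w\<close> lies in \<open>N\<close>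
  (\<open>coefficients_in_submodule\<close>).

  To see this, give \<open>d\<^sub>-\<^sub>k\<close> the weight \<open>k + 1\<close>. Since \<open>[d\<^sub>-\<^sub>i, d\<^sub>-\<^sub>j]\<close> is a multiple of
  \<open>d\<^sub>-\<^sub>(\<^sub>i\<^sub>+\<^sub>j\<^sub>)\<close>, of weight \<open>i + j + 1 < (i + 1) + (j + 1)\<close>, the order of the factors does not matter up
  to terms of lower weight. Commuting \<open>E\<^sub>n\<close> past \<open>d\<^sub>-\<^sub>k\<close> lowers the weight by \<open>n\<close> or more, with one
  exception: for \<open>k = n - 2\<close> the bracket is a multiple of \<open>d\<^sub>2\<close>, which acts by the nonzero scalar
  \<open>\<psi>(d\<^sub>2)\<close> to leading order, and the loss is only \<open>n - 1\<close>. So on the associated graded space, a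
  polynomial algebra in commuting variables \<open>x\<^sub>k\<close>, the operator \<open>E\<^sub>k\<^sub>+\<^sub>2\<close> is a nonzero multiple of
  \<open>\<partial>/\<partial>x\<^sub>k\<close> (\<open>twist_lower\<close>). If \<open>\<lambda>\<close> has the greatest weight in the sum above, then the product of the
  \<open>E\<^sub>k\<^sub>+\<^sub>2\<close> with \<open>k \<in> \<lambda>\<close> kills all terms except that of \<open>\<lambda>\<close>, which becomes a nonzero multiple of
  \<open>q\<^sub>\<lambda>(z) w\<close>. This gives \<open>q\<^sub>\<lambda>(z) w \<in> N\<close>, the term of \<open>\<lambda>\<close> can be subtracted, and induction
  applies.

  Hence a submodule is determined by the ideal of all \<open>q\<close> with \<open>q(z) w \<in> N\<close>: it is \<open>g(z) V\<close> for the
  generator \<open>g\<close> of this ideal (\<open>submodule_principal\<close>), and inclusion of submodules is divisibility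
  (\<open>range_zpoly_subset_iff\<close>). The submodules of \<open>V\<^sub>j = p\<^sub>j(z) V\<close> are therefore the members of the chain
  \<open>p\<^sub>j(z) (z - \<xi>\<^sub>j)\<^sup>i V\<close> for \<open>0 \<le> i \<le> a\<^sub>j\<close>, from which indecomposability, the simplicity criterion and
  the length are read off. The direct sum decomposition is the primary decomposition of \<open>V\<close> with
  respect to the action of \<open>z\<close>, a consequence of the coprimality of the \<open>(z - \<xi>\<^sub>j)\<^sup>a\<^sup>j\<close>.
\<close>

section \<open>Univariate polynomials over a field\<close>

lemma poly_ideal_principal:
  fixes I :: "'a::field poly set"
  assumes "0 \<in> I" "\<And>q r. q \<in> I \<Longrightarrow> r \<in> I \<Longrightarrow> q - r \<in> I" "\<And>q r. q \<in> I \<Longrightarrow> r * q \<in> I"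
  shows "\<exists>g. \<forall>q. q \<in> I \<longleftrightarrow> g dvd q"
proof (cases "I \<subseteq> {0}")
  case True
  then show ?thesis using assms(1) by (intro exI[of _ 0]) auto
next
  case False
  then have "\<exists>g. g \<in> I \<and> g \<noteq> 0" by blast
  then obtain g where g: "g \<in> I" "g \<noteq> 0" and least: "\<And>q. q \<in> I \<Longrightarrow> q \<noteq> 0 \<Longrightarrow> degree g \<le> degree q"
    using ex_has_least_nat[of "\<lambda>g. g \<in> I \<and> g \<noteq> 0" _ degree] by blast
  have "g dvd q" if "q \<in> I" for q
  proof -
    have "q - q div g * g \<in> I" by (intro assms g that)
    then have "q mod g \<in> I" by (simp add: minus_div_mult_eq_mod)
    then have "q mod g = 0" using least[of "q mod g"] degree_mod_less'[OF g(2), of q] by fastforce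
    then show ?thesis by (simp add: dvd_eq_mod_eq_0)
  qed
  then show ?thesis using g(1) assms(3) by (intro exI[of _ g]) (auto elim!: dvdE simp: mult.commute)
qed

lemma linear_power_dvd_iff:
  fixes x :: "'a::field"
  shows "[:- x, 1:] ^ i dvd [:- x, 1:] ^ j \<longleftrightarrow> i \<le> j"
  by (subst dvd_power_iff) (auto simp: is_unit_iff_degree)

lemma divides_linear_power:
  fixes x :: "'a::field_gcd"
  assumes "h dvd [:- x, 1:] ^ n"
  obtains i where "i \<le> n" "normalize h = normalize ([:- x, 1:] ^ i)"
proof -
  have "prime_elem [:- x, 1:]" by (simp add: prime_elem_linear_poly)
  moreover have "normalize [:- x, 1:] = [:- x, 1:]" by (simp add: normalize_poly_def flip: one_pCons)
  ultimately have "prime [:- x, 1:]" by (simp add: prime_def)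
  then show ?thesis using divides_primepow_weak[OF _ assms] that by blast
qed

lemma coprime_linear_powers:
  fixes x y :: "'a::field_gcd"
  assumes "x \<noteq> y"
  shows "coprime ([:- x, 1:] ^ m) ([:- y, 1:] ^ n)"
proof -
  have "coprime [:- x, 1:] [:- y, 1:]"
  proof (rule coprimeI)
    fix d assume "d dvd [:- x, 1:]" "d dvd [:- y, 1:]"
    then have "d dvd [:- x, 1:] - [:- y, 1:]" by (rule dvd_diff)
    then have "d dvd [:y - x:]" by simp
    moreover have "[:y - x:] dvd 1" using assms by (simp add: is_unit_const_poly_iff dvd_field_iff)
    ultimately show "is_unit d" by (rule dvd_trans)
  qed
  then show ?thesis by simp
qed

text \<open>
  For several moduli the Bezout identity is stated as a congruence modulo the product, so that it
  also covers the empty index set, where the sum is \<open>0\<close> and the modulus is \<open>1\<close>.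
\<close>

lemma partition_of_unity:
  fixes q :: "'i \<Rightarrow> 'a::euclidean_ring_gcd"
  assumes "finite I" "\<And>i j. i \<in> I \<Longrightarrow> j \<in> I \<Longrightarrow> i \<noteq> j \<Longrightarrow> coprime (q i) (q j)"
  shows "\<exists>r. (\<Prod>i\<in>I. q i) dvd 1 - (\<Sum>j\<in>I. r j * (\<Prod>i\<in>I - {j}. q i))"
  using assms
proof (induction I)
  case empty
  show ?case by simp
next
  case (insert x I)
  let ?p = "\<Prod>i\<in>I. q i" and ?c = "\<lambda>j. \<Prod>i\<in>I - {j}. q i"
  have "\<exists>r. ?p dvd 1 - (\<Sum>j\<in>I. r j * ?c j)"
    using insert.IH insert.prems by simp
  then obtain r s where rs: "1 - (\<Sum>j\<in>I. r j * ?c j) = ?p * s" by (elim exE dvdE)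
  have r: "(\<Sum>j\<in>I. r j * ?c j) = 1 - ?p * s" unfolding rs[symmetric] by simp
  have "coprime (q x) ?p" using insert.hyps insert.prems by (intro prod_coprime_right) auto
  then have "gcd (q x) ?p = 1" by (rule coprime_imp_gcd_eq_1)
  then obtain u v where uv: "u * q x + v * ?p = 1"
    using bezout_coefficients_fst_snd[of "q x" ?p] by (simp only:)
  let ?r = "\<lambda>j. if j = x then v else u * r j"
  have "(\<Prod>i\<in>insert x I - {j}. q i) = q x * ?c j" if "j \<in> I" for j
  proof -
    have "insert x I - {j} = insert x (I - {j})" using that insert.hyps by auto
    then show ?thesis using insert.hyps by simp
  qed
  then have "(\<Sum>j\<in>I. ?r j * (\<Prod>i\<in>insert x I - {j}. q i)) = (\<Sum>j\<in>I. u * q x * (r j * ?c j))"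
    using insert.hyps by (intro sum.cong) auto
  then have "(\<Sum>j\<in>insert x I. ?r j * (\<Prod>i\<in>insert x I - {j}. q i)) =
      v * ?p + u * q x * (\<Sum>j\<in>I. r j * ?c j)"
    using insert.hyps by (simp add: sum_distrib_left)
  also have "\<dots> = (u * q x + v * ?p) - q x * ?p * (u * s)"
    unfolding r by (simp add: algebra_simps)
  finally have "1 - (\<Sum>j\<in>insert x I. ?r j * (\<Prod>i\<in>insert x I - {j}. q i)) = q x * ?p * (u * s)"
    unfolding uv by simp
  then have "q x * ?p dvd 1 - (\<Sum>j\<in>insert x I. ?r j * (\<Prod>i\<in>insert x I - {j}. q i))"
    by (rule dvdI)
  then show ?case unfolding prod.insert[OF insert.hyps(1,2)] by (rule exI[of _ ?r])
qed

section \<open>The action of the centre and generated submodules\<close>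

context virasoro_module
begin

lemma act_simps [simp]:
  "act x (u + v) = act x u + act x v"
  "act x (scale c v) = scale c (act x v)"
  "act x 0 = 0"
  "act x (u - v) = act x u - act x v"
  "act x (- v) = - act x v"
proof -
  interpret l: Vector_Spaces.linear scale scale "act x" by (rule linear_act_right)
  show "act x (u + v) = act x u + act x v" "act x (scale c v) = scale c (act x v)"
    "act x 0 = 0" "act x (u - v) = act x u - act x v" "act x (- v) = - act x v"
    by (simp_all add: l.add l.scale l.zero l.diff l.neg)
qed

lemma act_left_simps:
  "act (x + y) v = act x v + act y v"
  "act (vscale c x) v = scale c (act x v)"
  "act 0 v = 0"
proof -
  interpret l: Vector_Spaces.linear vscale scale "\<lambda>x. act x v" by (rule linear_act_left)
  show "act (x + y) v = act x v + act y v" "act (vscale c x) v = scale c (act x v)" "act 0 v = 0"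
    by (simp_all add: l.add l.scale l.zero)
qed

lemma act_commute: "act x (act y v) = act y (act x v) + act (bracket x y) v"
  by (simp add: act_bracket)

lemma act_z_commute: "act vir_z (act x v) = act x (act vir_z v)"
  using act_commute[of vir_z x v] by (simp add: bracket_z act_left_simps)

lemma zpoly_superset:
  assumes "degree q \<le> n"
  shows "zpoly q v = (\<Sum>i\<le>n. scale (coeff q i) ((act vir_z ^^ i) v))"
  unfolding zpoly_def
  by (rule sum.mono_neutral_left) (use assms in \<open>auto simp: coeff_eq_0\<close>)

lemma zpoly_add: "zpoly (q + r) v = zpoly q v + zpoly r v"
proof -
  let ?n = "max (degree q) (degree r)"
  have "degree (q + r) \<le> ?n" by (rule degree_add_le_max)
  then show ?thesis
    by (simp add: zpoly_superset[of _ ?n] scale_left_distrib sum.distrib)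
qed

lemma zpoly_smult: "zpoly (smult c q) v = scale c (zpoly q v)"
proof -
  have "degree (smult c q) \<le> degree q" by (rule degree_smult_le)
  then show ?thesis
    by (simp add: zpoly_superset[of _ "degree q"] scale_sum_right)
qed

lemma zpoly_zero [simp]: "zpoly 0 v = 0"
  by (simp add: zpoly_def)

lemma zpoly_pCons: "zpoly (pCons c q) v = scale c v + zpoly q (act vir_z v)"
proof -
  have "degree (pCons c q) \<le> Suc (degree q)" by (rule degree_pCons_le)
  then have "zpoly (pCons c q) v =
      (\<Sum>i\<le>Suc (degree q). scale (coeff (pCons c q) i) ((act vir_z ^^ i) v))"
    by (rule zpoly_superset)
  also have "\<dots> = scale c v + (\<Sum>i\<le>degree q. scale (coeff q i) ((act vir_z ^^ Suc i) v))"
    by (simp only: sum.atMost_Suc_shift) simp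
  finally show ?thesis
    by (simp only: funpow_Suc_right o_apply zpoly_def)
qed

lemma zpoly_one [simp]: "zpoly 1 v = v"
  by (simp add: one_pCons zpoly_pCons)

lemma zpoly_linear:
  "zpoly q (u + v) = zpoly q u + zpoly q v"
  "zpoly q (scale c v) = scale c (zpoly q v)"
  by (induction q arbitrary: u v) (simp_all add: zpoly_pCons scale_right_distrib mult.commute)

lemma zpoly_zero_right [simp]: "zpoly q 0 = 0"
  using zpoly_linear(1)[of q 0 0] by simp

lemma zpoly_sum: "zpoly q (sum f A) = (\<Sum>i\<in>A. zpoly q (f i))"
  by (induction A rule: infinite_finite_induct) (simp_all add: zpoly_linear)

lemma zpoly_sum_left: "zpoly (sum f A) v = (\<Sum>i\<in>A. zpoly (f i) v)"
  by (induction A rule: infinite_finite_induct) (simp_all add: zpoly_add)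

lemma act_zpoly: "act x (zpoly q v) = zpoly q (act x v)"
  by (induction q arbitrary: v) (simp_all add: zpoly_pCons act_z_commute)

lemma zpoly_mult: "zpoly (q * r) v = zpoly q (zpoly r v)"
  by (induction q arbitrary: v) (simp_all add: zpoly_pCons zpoly_add zpoly_smult act_zpoly)

lemma zpoly_diff: "zpoly (q - r) v = zpoly q v - zpoly r v"
  using zpoly_add[of "q - r" r v] by simp

lemma whittaker_vector_zpoly:
  "whittaker_vector \<psi> v \<Longrightarrow> whittaker_vector \<psi> (zpoly q v)"
  by (simp add: whittaker_vector_def act_zpoly zpoly_linear)

lemma submoduleD:
  assumes "submodule N"
  shows "0 \<in> N" "u \<in> N \<Longrightarrow> v \<in> N \<Longrightarrow> u + v \<in> N" "u \<in> N \<Longrightarrow> scale c u \<in> N"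
    "u \<in> N \<Longrightarrow> v \<in> N \<Longrightarrow> u - v \<in> N" "u \<in> N \<Longrightarrow> act x u \<in> N"
  using assms by (auto simp: submodule_def subspace_0 subspace_add subspace_scale subspace_diff)

lemma zpoly_in_submodule: "submodule N \<Longrightarrow> v \<in> N \<Longrightarrow> zpoly q v \<in> N"
  by (induction q arbitrary: v) (simp_all add: zpoly_pCons submoduleD)

lemma submodule_zero: "submodule {0}"
  by (simp add: submodule_def)

lemma submodule_gen: "submodule (gen v)"
proof -
  have "act x u \<in> gen v" if "u \<in> gen v" for x u
    using that unfolding gen_def
  proof (induction rule: span_induct_alt)
    case (step c b y)
    then obtain xs where "b = foldr act xs v" by auto
    then have "act x b \<in> {foldr act xs v |xs. True}" by (auto intro: exI[of _ "x # xs"])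
    with step show ?case by (simp add: span_add span_scale span_base)
  qed (simp add: span_zero)
  then show ?thesis by (simp add: submodule_def gen_def)
qed

lemma gen_self: "v \<in> gen v"
  unfolding gen_def by (rule span_base) (auto intro: exI[of _ "[]"])

lemma gen_minimal:
  assumes "submodule N" "v \<in> N"
  shows "gen v \<subseteq> N"
proof -
  have "foldr act xs v \<in> N" for xs
    by (induction xs) (simp_all add: assms submoduleD)
  then show ?thesis
    unfolding gen_def using assms(1) by (intro span_minimal) (auto simp: submodule_def)
qed

lemma submodule_zpoly_image:
  assumes "submodule N"
  shows "submodule (zpoly q ` N)"
  unfolding submodule_def subspace_def
proof (intro conjI ballI allI)
  show "0 \<in> zpoly q ` N" using submoduleD(1)[OF assms] by (rule rev_image_eqI) simp
next
  fix x y assume "x \<in> zpoly q ` N" "y \<in> zpoly q ` N"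
  then show "x + y \<in> zpoly q ` N"
    using submoduleD(2)[OF assms] by (auto simp flip: zpoly_linear)
next
  fix c x assume "x \<in> zpoly q ` N"
  then show "scale c x \<in> zpoly q ` N"
    using submoduleD(3)[OF assms] by (auto simp flip: zpoly_linear)
next
  fix x v assume "v \<in> zpoly q ` N"
  then show "act x v \<in> zpoly q ` N"
    using submoduleD(5)[OF assms] by (auto simp: act_zpoly)
qed

text \<open>
  A polynomial in the central element commutes with the action of the Lie algebra, so it maps the
  spanning set of one generated submodule onto that of the other.
\<close>

lemma gen_zpoly: "gen (zpoly q v) = zpoly q ` gen v"
proof
  show "gen (zpoly q v) \<subseteq> zpoly q ` gen v"
    by (intro gen_minimal submodule_zpoly_image submodule_gen imageI gen_self)
  have "zpoly q u \<in> gen (zpoly q v)" if "u \<in> gen v" for u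
    using that unfolding gen_def[of v]
  proof (induction rule: span_induct_alt)
    case (step c b y)
    then obtain xs where b: "b = foldr act xs v" by auto
    have "zpoly q (foldr act xs v) = foldr act xs (zpoly q v)"
      by (induction xs) (simp_all flip: act_zpoly)
    then have "zpoly q b \<in> gen (zpoly q v)"
      unfolding gen_def b by (auto intro: span_base)
    with step show ?case
      by (simp add: zpoly_linear submoduleD[OF submodule_gen])
  qed (simp add: submoduleD[OF submodule_gen])
  then show "zpoly q ` gen v \<subseteq> gen (zpoly q v)" by blast
qed

end

section \<open>Modules whose submodules form a finite chain\<close>

text \<open>
  The chain \<open>C\<close> is indexed upwards, \<open>C 0 = {0}\<close> and \<open>C n = M\<close>; both equations follow from the
  assumptions.
\<close>

locale uniserial = virasoro_module scale act
  for scale :: "complex \<Rightarrow> 'v::ab_group_add \<Rightarrow> 'v" and act +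
  fixes M :: "'v set" and n :: nat and C :: "nat \<Rightarrow> 'v set"
  assumes submodule_iff: "submodule N \<and> N \<subseteq> M \<longleftrightarrow> (\<exists>i\<le>n. N = C i)"
    and subset_iff: "i \<le> n \<Longrightarrow> j \<le> n \<Longrightarrow> C i \<subseteq> C j \<longleftrightarrow> i \<le> j"
    and submodule_M: "submodule M"
begin

lemma eq_iff: "i \<le> n \<Longrightarrow> j \<le> n \<Longrightarrow> C i = C j \<longleftrightarrow> i = j"
  using subset_iff[of i j] subset_iff[of j i] by auto

lemma C_submodule: "i \<le> n \<Longrightarrow> submodule (C i)"
  using submodule_iff[of "C i"] by auto

lemma C_n: "C n = M"
proof -
  obtain i where i: "i \<le> n" "M = C i" using submodule_iff[of M] submodule_M by auto
  have "C n \<subseteq> M" using submodule_iff[of "C n"] by auto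
  then show ?thesis using i subset_iff[of n i] by auto
qed

lemma C_0: "C 0 = {0}"
proof -
  obtain i where i: "i \<le> n" "{0} = C i"
    using submodule_iff[of "{0}"] submodule_zero submodule_M submoduleD(1) by auto
  have "C i \<subseteq> C 0" using i(2)[symmetric] submoduleD(1)[OF C_submodule[of 0]] by simp
  then show ?thesis using i subset_iff[of i 0] by auto
qed

lemma simple_iff: "simple M \<longleftrightarrow> n = 1"
proof
  assume simple: "simple M"
  then have "C n \<noteq> C 0" using C_n C_0 by (simp add: simple_def)
  then have n: "n > 0" by (cases n) auto
  then have "1 \<le> n" by simp
  then have "submodule (C 1) \<and> C 1 \<subseteq> M" using submodule_iff[of "C 1"] by blast
  then have "C 1 = {0} \<or> C 1 = M" using simple by (simp add: simple_def)
  then have "C 1 = C 0 \<or> C 1 = C n" by (simp only: C_0 C_n)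
  then show "n = 1" using n eq_iff[of 1 0] eq_iff[of 1 n] by auto
next
  assume n: "n = 1"
  then have "M \<noteq> {0}" using eq_iff[of n 0] C_n C_0 by simp
  moreover have "N = {0} \<or> N = M" if N: "submodule N \<and> N \<subseteq> M" for N
  proof -
    obtain i where "i \<le> n" "N = C i" using N submodule_iff[of N] by blast
    then have "N = C 0 \<or> N = C n" using n by (cases i) auto
    then show ?thesis by (simp only: C_0 C_n)
  qed
  ultimately show "simple M" using submodule_M by (simp add: simple_def)
qed

text \<open>
  Of two members of a chain one contains the other, so two nonzero submodules never meet in \<open>{0}\<close>.
\<close>

lemma indecomposable:
  assumes "n > 0"
  shows "indecomposable M"
proof -
  have "M \<noteq> {0}" using assms eq_iff[of n 0] C_n C_0 by simp
  moreover have False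
    if AB: "submodule A" "submodule B" "A \<noteq> {0}" "B \<noteq> {0}" "A \<inter> B = {0}"
      "M = {a + b |a b. a \<in> A \<and> b \<in> B}" for A B
  proof -
    have "A \<subseteq> M"
    proof
      fix x assume "x \<in> A"
      then have "x + 0 \<in> M" unfolding AB(6) using submoduleD(1)[OF AB(2)] by blast
      then show "x \<in> M" by simp
    qed
    moreover have "B \<subseteq> M"
    proof
      fix x assume "x \<in> B"
      then have "0 + x \<in> M" unfolding AB(6) using submoduleD(1)[OF AB(1)] by blast
      then show "x \<in> M" by simp
    qed
    ultimately obtain i j where "i \<le> n" "A = C i" "j \<le> n" "B = C j"
      using AB(1,2) submodule_iff[of A] submodule_iff[of B] by blast
    then have "A \<subseteq> B \<or> B \<subseteq> A" using subset_iff[of i j] subset_iff[of j i] by auto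
    then show False using AB(3-5) by blast
  qed
  ultimately show ?thesis using submodule_M unfolding indecomposable_def by blast
qed

text \<open>
  The chain of all submodules is a composition series. Conversely a composition series cannot skip a
  member of the chain, because that member would contradict maximality, so its \<open>i\<close>-th term is \<open>C i\<close>.
\<close>

lemma composition_length: "composition_length M n"
proof -
  have "composition_series M n C"
    unfolding composition_series_def
  proof (intro conjI allI impI C_0 C_n C_submodule)
    fix i assume i: "i < n"
    then have i': "i \<le> n" "Suc i \<le> n" by simp_all
    show "C i \<subset> C (Suc i)" using subset_iff[OF i'] eq_iff[OF i'] by (simp add: psubset_eq)
    fix N assume N: "submodule N \<and> C i \<subseteq> N \<and> N \<subseteq> C (Suc i)"
    have "C (Suc i) \<subseteq> M" using i' submodule_iff[of "C (Suc i)"] by blast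
    then obtain t where t: "t \<le> n" "N = C t" using N submodule_iff[of N] by blast
    then have "i \<le> t" "t \<le> Suc i" using N subset_iff i' by simp_all
    then have "t = i \<or> t = Suc i" by linarith
    then show "N = C i \<or> N = C (Suc i)" unfolding t(2) by (elim disjE) simp_all
  qed
  moreover have "m = n" if F: "composition_series M m F" for m F
  proof -
    have F_0: "F 0 = {0}" and F_m: "F m = M"
      and F_submodule: "\<And>i. i \<le> m \<Longrightarrow> submodule (F i)"
      and F_less: "\<And>i. i < m \<Longrightarrow> F i \<subset> F (Suc i)"
      and F_max: "\<And>i N. i < m \<Longrightarrow> submodule N \<Longrightarrow> F i \<subseteq> N \<Longrightarrow> N \<subseteq> F (Suc i) \<Longrightarrow>
        N = F i \<or> N = F (Suc i)"
      using F unfolding composition_series_def by simp_all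
    have F_mono: "F i \<subseteq> F j" if "i \<le> j" "j \<le> m" for i j
      using that
    proof (induction j rule: dec_induct)
      case (step j)
      then show ?case using F_less[of j] by simp
    qed simp
    have *: "i \<le> n \<and> F i = C i" if "i \<le> m" for i
      using that
    proof (induction i)
      case 0
      then show ?case by (simp add: F_0 C_0)
    next
      case (Suc i)
      then have IH: "i \<le> n" "F i = C i" and i: "i < m" by simp_all
      have "F (Suc i) \<subseteq> M" using F_mono[OF Suc.prems order_refl] F_m by simp
      then obtain t where t: "t \<le> n" "F (Suc i) = C t"
        using submodule_iff[of "F (Suc i)"] F_submodule[OF Suc.prems] by blast
      have "C i \<subset> C t" using F_less[OF i] IH(2) t(2) by simp
      then have "\<not> t \<le> i" using subset_iff[of t i] t(1) IH(1) by blast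
      then have it: "Suc i \<le> t" "Suc i \<le> n" using t(1) by simp_all
      have "C (Suc i) = F i \<or> C (Suc i) = F (Suc i)"
        using it t IH by (intro F_max i C_submodule) (simp_all add: subset_iff)
      moreover have "C (Suc i) \<noteq> F i" using eq_iff[of "Suc i" i] it(2) IH by simp
      ultimately show ?case using it(2) by simp
    qed
    from *[OF order_refl] have m: "m \<le> n" "F m = C m" by blast+
    have "C m = C n" unfolding m(2)[symmetric] F_m C_n ..
    then show ?thesis using eq_iff[OF m(1) order_refl] by blast
  qed
  ultimately show ?thesis
    unfolding composition_length_def by (intro conjI exI allI impI)
qed

end

section \<open>Monomials in the lowering operators and their weight\<close>

text \<open>
  Entry \<open>k\<close> of the list stands for \<open>d\<^sub>-\<^sub>k\<close>. The weight \<open>k + 1\<close>, rather than \<open>k\<close>, makes \<open>d\<^sub>0\<close> count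
  and makes the bracket of two lowering operators lighter than their product. Integer values avoid
  truncated subtraction in statements about a loss of weight.
\<close>

definition weight :: "nat list \<Rightarrow> int" where
  "weight ks = (\<Sum>k\<leftarrow>ks. int k + 1)"

lemma weight_simps [simp]:
  "weight [] = 0"
  "weight (k # ks) = int k + 1 + weight ks"
  by (simp_all add: weight_def)

lemma weight_nonneg [simp]: "weight ks \<ge> 0"
  by (induction ks) simp_all

lemma weight_le_0_iff: "weight ks \<le> 0 \<longleftrightarrow> ks = []"
proof (cases ks)
  case (Cons k ks')
  then show ?thesis using weight_nonneg[of ks'] by (simp del: weight_nonneg)
qed simp

lemma weight_remove1: "k \<in> set ks \<Longrightarrow> weight (remove1 k ks) = weight ks - (int k + 1)"
  by (induction ks) auto

locale whittaker_cyclic = virasoro_module scale act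
  for scale :: "complex \<Rightarrow> 'v::ab_group_add \<Rightarrow> 'v" and act +
  fixes \<psi> :: "virasoro \<Rightarrow> complex" and w :: 'v
  assumes lie_hom: "lie_hom_n_plus \<psi>"
    and psi_2: "\<psi> (vir_d 2) \<noteq> 0"
    and whittaker_w: "whittaker_vector \<psi> w"
    and gen_w: "gen w = UNIV"
begin

definition lower :: "nat list \<Rightarrow> 'v \<Rightarrow> 'v" where
  "lower ks = foldr (\<lambda>k. act (vir_d (- int k))) ks"

text \<open>
  The operator \<open>E\<^sub>n\<close>: for \<open>n \<ge> 1\<close> it kills Whittaker vectors, so that its effect on a monomial
  applied to \<open>w\<close> comes from brackets with the lowering operators alone.
\<close>

definition twist :: "int \<Rightarrow> 'v \<Rightarrow> 'v" where
  "twist n v = act (vir_d n) v - scale (\<psi> (vir_d n)) v"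

text \<open>
  The filtration by weight, indexed with a strict bound so that it vanishes for \<open>m \<le> 0\<close>
  and \<open>filt (weight ks)\<close> contains the terms that are negligible next to \<open>lower ks\<close>. It is stable
  under \<open>z\<close>, which has weight \<open>0\<close>.
\<close>

definition filt :: "int \<Rightarrow> 'v set" where
  "filt m = span {lower ks (zpoly q w) |ks q. weight ks < m}"

lemma lower_simps [simp]:
  "lower [] v = v"
  "lower (k # ks) v = act (vir_d (- int k)) (lower ks v)"
  by (simp_all add: lower_def)

lemma lower_linear:
  "lower ks (u + v) = lower ks u + lower ks v"
  "lower ks (u - v) = lower ks u - lower ks v"
  "lower ks (scale c v) = scale c (lower ks v)"
  "lower ks 0 = 0"
  by (induction ks) simp_all

lemma lower_zpoly: "lower ks (zpoly q v) = zpoly q (lower ks v)"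
  by (induction ks) (simp_all add: act_zpoly)

lemma lower_in_submodule: "submodule N \<Longrightarrow> v \<in> N \<Longrightarrow> lower ks v \<in> N"
  by (induction ks) (simp_all add: submoduleD)

lemma twist_linear:
  "twist n (u + v) = twist n u + twist n v"
  "twist n (scale c v) = scale c (twist n v)"
  "twist n 0 = 0"
  by (simp_all add: twist_def scale_right_distrib scale_right_diff_distrib mult.commute)

lemma act_twist: "act (vir_d n) v = scale (\<psi> (vir_d n)) v + twist n v"
  by (simp add: twist_def)

lemma vir_d_n_plus: "n \<ge> 1 \<Longrightarrow> vir_d n \<in> n_plus"
  unfolding n_plus_def by (rule vir.span_base) simp

text \<open>
  A homomorphism to an abelian Lie algebra kills brackets, and \<open>d\<^sub>n\<close> is a nonzero multiple of
  \<open>[d\<^sub>1, d\<^sub>n\<^sub>-\<^sub>1]\<close> for \<open>n \<ge> 3\<close>.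
\<close>

lemma psi_ge_3: "\<psi> (vir_d n) = 0" if "n \<ge> 3"
proof -
  have "bracket (vir_d 1) (vir_d (n - 1)) = vscale (of_int (n - 2)) (vir_d n)"
    using that by (simp add: bracket_d_d)
  moreover have "\<psi> (bracket (vir_d 1) (vir_d (n - 1))) = 0"
    using lie_hom that vir_d_n_plus[of 1] vir_d_n_plus[of "n - 1"]
    unfolding lie_hom_n_plus_def by simp
  moreover have "\<psi> (vscale (of_int (n - 2)) (vir_d n)) = of_int (n - 2) * \<psi> (vir_d n)"
    using lie_hom that vir_d_n_plus[of n] unfolding lie_hom_n_plus_def by simp
  ultimately have "of_int (n - 2) * \<psi> (vir_d n) = 0" by simp
  moreover have "(of_int (n - 2) :: complex) \<noteq> 0"
    unfolding of_int_eq_0_iff using that by simp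
  ultimately show ?thesis by (metis mult_eq_0_iff)
qed

lemma twist_w: "n \<ge> 1 \<Longrightarrow> twist n (zpoly q w) = 0"
  using whittaker_vector_zpoly[OF whittaker_w, of q] vir_d_n_plus[of n]
  by (simp add: twist_def whittaker_vector_def)

lemma filt_base: "weight ks < m \<Longrightarrow> lower ks (zpoly q w) \<in> filt m"
  unfolding filt_def by (rule span_base) blast

lemma filt_simps:
  "0 \<in> filt m" "u \<in> filt m \<Longrightarrow> v \<in> filt m \<Longrightarrow> u + v \<in> filt m"
  "u \<in> filt m \<Longrightarrow> scale c u \<in> filt m" "u \<in> filt m \<Longrightarrow> - u \<in> filt m"
  "u \<in> filt m \<Longrightarrow> v \<in> filt m \<Longrightarrow> u - v \<in> filt m"
  by (simp_all add: filt_def span_zero span_add span_scale span_neg span_diff)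

lemma filt_mono: "m \<le> n \<Longrightarrow> v \<in> filt m \<Longrightarrow> v \<in> filt n"
  unfolding filt_def by (erule subsetD[OF span_mono, rotated]) auto

lemma filt_nonpos: "v = 0" if "v \<in> filt m" "m \<le> 0"
proof -
  have "\<not> weight ks < m" for ks using that(2) weight_nonneg[of ks] by linarith
  then have "{lower ks (zpoly q w) |ks q. weight ks < m} = {}" by blast
  with that(1) show ?thesis by (simp only: filt_def span_empty singleton_iff)
qed

lemma filt_induct [consumes 1, case_names zero step]:
  assumes "v \<in> filt m" "P 0"
    "\<And>c ks q u. weight ks < m \<Longrightarrow> u \<in> filt m \<Longrightarrow> P u \<Longrightarrow> P (scale c (lower ks (zpoly q w)) + u)"
  shows "P v"
proof -
  have "v \<in> filt m \<and> P v"
    using assms(1) unfolding filt_def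
  proof (induction rule: span_induct_alt)
    case base
    show ?case by (simp add: assms(2) span_zero)
  next
    case (step c b y)
    then obtain ks q where "b = lower ks (zpoly q w)" "weight ks < m" by blast
    with step assms(3)[of ks y c q] show ?case
      unfolding filt_def by (auto intro!: span_add span_scale intro: span_base)
  qed
  then show ?thesis ..
qed

lemma act_lower_filt: "v \<in> filt m \<Longrightarrow> act (vir_d (- int k)) v \<in> filt (m + int k + 1)"
proof (induction rule: filt_induct)
  case (step c ks q u)
  have "lower (k # ks) (zpoly q w) \<in> filt (m + int k + 1)"
    by (rule filt_base) (use step in simp)
  with step show ?case by (simp add: filt_simps)
qed (simp add: filt_simps)

text \<open>
  The bracket of \<open>d\<^sub>-\<^sub>i\<close> and \<open>d\<^sub>-\<^sub>j\<close> is a multiple of a single operator of weight \<open>i + j + 1\<close>; it has no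
  central term, as that could only occur for \<open>i = j = 0\<close>.
\<close>

lemma lower_swap:
  "lower (i # j # ks) (zpoly q w) - lower (j # i # ks) (zpoly q w) \<in> filt (weight (i # j # ks))"
proof -
  let ?v = "lower ks (zpoly q w)"
  have "bracket (vir_d (- int i)) (vir_d (- int j)) =
      vscale (of_int (int i - int j)) (vir_d (- int (i + j)))"
    by (auto simp: bracket_d_d)
  then have "lower (i # j # ks) (zpoly q w) - lower (j # i # ks) (zpoly q w) =
      scale (of_int (int i - int j)) (lower ((i + j) # ks) (zpoly q w))"
    using act_commute[of "vir_d (- int i)" "vir_d (- int j)" ?v] by (simp add: act_left_simps)
  moreover have "lower ((i + j) # ks) (zpoly q w) \<in> filt (weight (i # j # ks))"
    by (rule filt_base) simp
  ultimately show ?thesis by (metis filt_simps(3))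
qed

lemma lower_move_front:
  "k \<in> set ks \<Longrightarrow> lower ks (zpoly q w) - lower (k # remove1 k ks) (zpoly q w) \<in> filt (weight ks)"
proof (induction ks)
  case (Cons j ks)
  show ?case
  proof (cases "j = k")
    case True
    then show ?thesis by (simp add: filt_simps)
  next
    case False
    with Cons have k: "k \<in> set ks" by simp
    have "act (vir_d (- int j)) (lower ks (zpoly q w) - lower (k # remove1 k ks) (zpoly q w))
        \<in> filt (weight ks + int j + 1)"
      by (rule act_lower_filt) (use Cons k in blast)
    then have 1: "lower (j # ks) (zpoly q w) - lower (j # k # remove1 k ks) (zpoly q w)
        \<in> filt (weight (j # ks))"
      by (simp add: algebra_simps)
    have 2: "lower (j # k # remove1 k ks) (zpoly q w) - lower (k # j # remove1 k ks) (zpoly q w)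
        \<in> filt (weight (j # ks))"
      using lower_swap[of j k "remove1 k ks" q] by (simp add: weight_remove1[OF k])
    from filt_simps(2)[OF 1 2] False show ?thesis by simp
  qed
qed simp

text \<open>
  The associated graded space is therefore acted on by commuting variables.
\<close>

lemma lower_perm:
  "mset ks = mset ls \<Longrightarrow> lower ks (zpoly q w) - lower ls (zpoly q w) \<in> filt (weight ks)"
proof (induction ls arbitrary: ks)
  case (Cons l ls)
  then have l: "l \<in> set ks" by (metis list.set_intros(1) set_mset_mset)
  have m: "mset (remove1 l ks) = mset ls" using Cons.prems by simp
  have 1: "lower ks (zpoly q w) - lower (l # remove1 l ks) (zpoly q w) \<in> filt (weight ks)"
    by (rule lower_move_front[OF l])
  have "act (vir_d (- int l)) (lower (remove1 l ks) (zpoly q w) - lower ls (zpoly q w))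
      \<in> filt (weight (remove1 l ks) + int l + 1)"
    by (rule act_lower_filt[OF Cons.IH[OF m]])
  then have 2: "lower (l # remove1 l ks) (zpoly q w) - lower (l # ls) (zpoly q w) \<in> filt (weight ks)"
    by (simp add: weight_remove1[OF l])
  from filt_simps(2)[OF 1 2] show ?case by simp
qed (simp add: filt_simps)

section \<open>Leading terms of the twisted action of positive elements\<close>

text \<open>
  Up to terms of lower weight this is \<open>- (2 n - 2) \<psi>(d\<^sub>2) \<partial>/\<partial>x\<^sub>n\<^sub>-\<^sub>2\<close> applied to the monomial of \<open>ks\<close>.
  For \<open>n = 1\<close> there is no such variable; the index \<open>nat (n - 2)\<close> is then \<open>0\<close>, but the first factor
  of the coefficient vanishes.
\<close>

definition lead :: "int \<Rightarrow> nat list \<Rightarrow> 'v \<Rightarrow> 'v" where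
  "lead n ks v = scale (- (2 * of_int n - 2) * \<psi> (vir_d 2) * of_nat (count (mset ks) (nat (n - 2))))
     (lower (remove1 (nat (n - 2)) ks) v)"

lemma lead_filt:
  assumes "n \<ge> 1"
  shows "lead n ks (zpoly q w) \<in> filt (weight ks - n + 2)"
proof (cases "n \<ge> 2 \<and> nat (n - 2) \<in> set ks")
  case True
  then show ?thesis
    unfolding lead_def by (intro filt_simps(3) filt_base) (simp add: weight_remove1)
next
  case False
  then have "n = 1 \<or> count (mset ks) (nat (n - 2)) = 0"
    using assms by (auto simp: not_in_iff[symmetric])
  then have "lead n ks (zpoly q w) = 0" by (auto simp: lead_def)
  then show ?thesis by (simp add: filt_simps)
qed

text \<open>
  The scalar \<open>\<psi>(d\<^sub>n)\<close> cancels, so only the bracket of \<open>d\<^sub>n\<close> with \<open>d\<^sub>-\<^sub>k\<close> remains besides the term in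
  which the two operators are exchanged.
\<close>

lemma twist_act_lower:
  "twist n (act (vir_d (- int k)) v) = act (vir_d (- int k)) (twist n v) +
     scale (- of_int (int k + n)) (act (vir_d (n - int k)) v) +
     (if int k = n then scale ((of_int n ^ 3 - of_int n) / 12) (act vir_z v) else 0)"
proof -
  have "of_int (- int k - n) = (- of_int (int k + n) :: complex)" by simp
  then show ?thesis
    using act_commute[of "vir_d n" "vir_d (- int k)" v]
    by (simp add: twist_def bracket_d_d act_left_simps)
qed

lemma act_z_lower: "act vir_z (lower ks (zpoly q w)) = lower ks (zpoly (pCons 0 q) w)"
proof (induction ks)
  case (Cons k ks)
  then show ?case by (simp add: act_z_commute)
qed (simp add: zpoly_pCons act_zpoly)

text \<open>
  Induction on the monomial \<open>d\<^sub>-\<^sub>k d\<^sub>-\<^sub>\<lambda>\<close>, for all \<open>n\<close> at once, comparing weights in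
  \<open>[d\<^sub>n, d\<^sub>-\<^sub>k] d\<^sub>-\<^sub>\<lambda>\<close>. For \<open>k \<ge> n\<close> the weight drops by \<open>n\<close>, or by \<open>k + 1\<close> in the central term. For
  \<open>k < n\<close> put \<open>m = n - k\<close> and \<open>d\<^sub>m = \<psi>(d\<^sub>m) + E\<^sub>m\<close>. By induction \<open>E\<^sub>m\<close> lowers the weight by at least
  \<open>m - 1\<close>, which together with the lost \<open>d\<^sub>-\<^sub>k\<close> makes \<open>n\<close>. The scalar \<open>\<psi>(d\<^sub>m)\<close> costs only the
  weight \<open>k + 1\<close> of \<open>d\<^sub>-\<^sub>k\<close>: this is \<open>n\<close> for \<open>m = 1\<close>, it is \<open>n - 1\<close> and contributes to the leading
  term for \<open>m = 2\<close>, and for \<open>m \<ge> 3\<close> the scalar is \<open>0\<close>.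
\<close>

lemma twist_lower:
  assumes "n \<ge> 1"
  shows "twist n (lower ks (zpoly q w)) - lead n ks (zpoly q w) \<in> filt (weight ks - n + 1)"
  using assms
proof (induction ks arbitrary: n)
  case Nil
  then show ?case by (simp add: twist_w lead_def filt_simps)
next
  case (Cons k ks)
  let ?u = "zpoly q w" and ?d = "act (vir_d (- int k))"
  let ?m = "weight (k # ks) - n + 1"
  have twist_mem: "twist m (lower ks ?u) \<in> filt (weight ks - m + 2)" if "m \<ge> 1" for m
  proof -
    have "twist m (lower ks ?u) - lead m ks ?u \<in> filt (weight ks - m + 2)"
      using Cons.IH[OF that] by (rule filt_mono[rotated]) simp
    from filt_simps(2)[OF this lead_filt[OF that, of ks q]] show ?thesis by simp
  qed
  have "?d (twist n (lower ks ?u) - lead n ks ?u) \<in> filt (weight ks - n + 1 + int k + 1)"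
    by (rule act_lower_filt[OF Cons.IH[OF Cons.prems]])
  then have 1: "?d (twist n (lower ks ?u)) - ?d (lead n ks ?u) \<in> filt ?m"
    by (simp add: algebra_simps)
  let ?c = "- of_int (int k + n) :: complex"
  let ?B = "scale ?c (act (vir_d (n - int k)) (lower ks ?u)) +
     (if int k = n then scale ((of_int n ^ 3 - of_int n) / 12) (act vir_z (lower ks ?u)) else 0)"
  have 2: "?d (lead n ks ?u) + ?B - lead n (k # ks) ?u \<in> filt ?m"
  proof (cases "n = int k + 2")
    \<comment> \<open>The only case with a new contribution to the leading term: the count of \<open>k\<close> goes up by one.\<close>
    case True
    let ?e = "?c * \<psi> (vir_d 2)" and ?N = "of_nat (count (mset ks) k) :: complex"
    have c: "- (2 * of_int n - 2) = ?c" using True by simp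
    have m: "?m = weight ks" using True by simp
    have d: "scale (?e * ?N) (lower (k # remove1 k ks) ?u - lower ks ?u) \<in> filt ?m"
    proof (cases "k \<in> set ks")
      case True
      have "- (lower ks ?u - lower (k # remove1 k ks) ?u) \<in> filt ?m"
        unfolding m by (rule filt_simps(4)[OF lower_move_front[OF True]])
      then show ?thesis unfolding minus_diff_eq by (rule filt_simps(3))
    next
      case False
      then have "count (mset ks) k = 0" by (simp add: not_in_iff[symmetric])
      then show ?thesis by (simp only: of_nat_0 mult_zero_right scale_zero_left filt_simps(1))
    qed
    have l1: "lead n ks ?u = scale (?e * ?N) (lower (remove1 k ks) ?u)"
      unfolding lead_def c using True by simp
    have l2: "lead n (k # ks) ?u = scale (?e * ?N + ?e) (lower ks ?u)"
      unfolding lead_def c using True by (simp add: algebra_simps)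
    have B: "?B = scale ?e (lower ks ?u) + scale ?c (twist 2 (lower ks ?u))"
      using True by (simp add: act_twist scale_right_distrib)
    have "?d (lead n ks ?u) + ?B - lead n (k # ks) ?u =
        scale (?e * ?N) (lower (k # remove1 k ks) ?u - lower ks ?u) + scale ?c (twist 2 (lower ks ?u))"
    proof -
      have "scale (e * N) x + (scale e y + t) - scale (e * N + e) y = scale (e * N) (x - y) + t"
        for e N x y t
        by (simp add: scale_left_distrib scale_right_diff_distrib)
      then show ?thesis unfolding l1 l2 B act_simps(2) lower_simps(2) .
    qed
    moreover have "scale ?c (twist 2 (lower ks ?u)) \<in> filt ?m"
      unfolding m using filt_simps(3)[OF twist_mem[of 2]] by simp
    ultimately show ?thesis using filt_simps(2)[OF d] by (simp only:)
  next
    case False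
    have "?d (lead n ks ?u) = lead n (k # ks) ?u"
    proof (cases "n = 1")
      case False
      with \<open>n \<noteq> int k + 2\<close> Cons.prems have "nat (n - 2) \<noteq> k" by linarith
      then show ?thesis by (simp add: lead_def)
    qed (simp add: lead_def)
    moreover have "?B \<in> filt ?m"
    proof (cases "n \<le> int k")
      case True
      then have "n - int k = - int (k - nat n)" using Cons.prems by linarith
      then have "act (vir_d (n - int k)) (lower ks ?u) = lower ((k - nat n) # ks) ?u" by simp
      moreover have "lower ((k - nat n) # ks) ?u \<in> filt ?m"
        by (rule filt_base) (use True Cons.prems in simp)
      moreover have "act vir_z (lower ks ?u) \<in> filt ?m" if "int k = n"
        unfolding act_z_lower by (rule filt_base) (use that in simp)
      ultimately show ?thesis by (simp add: filt_simps del: of_int_add)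
    next
      case gt: False
      have "scale (\<psi> (vir_d (n - int k))) (lower ks ?u) \<in> filt ?m"
      proof (cases "n - int k = 1")
        case True
        then show ?thesis by (intro filt_simps(3) filt_base) simp
      next
        case F: False
        with gt False have "n - int k \<ge> 3" by linarith
        then show ?thesis by (simp add: psi_ge_3 filt_simps)
      qed
      moreover have "twist (n - int k) (lower ks ?u) \<in> filt ?m"
        using twist_mem[of "n - int k"] gt by (simp add: algebra_simps)
      ultimately show ?thesis
        using gt by (simp add: act_twist filt_simps del: of_int_add)
    qed
    ultimately show ?thesis by simp
  qed
  have "twist n (lower (k # ks) ?u) = ?d (twist n (lower ks ?u)) + ?B"
    by (simp only: lower_simps twist_act_lower add.assoc)
  then have "twist n (lower (k # ks) ?u) - lead n (k # ks) ?u =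
    (?d (twist n (lower ks ?u)) - ?d (lead n ks ?u)) + (?d (lead n ks ?u) + ?B - lead n (k # ks) ?u)"
    by simp
  with filt_simps(2)[OF 1 2] show ?case by (simp only:)
qed

lemma twist_filt: "v \<in> filt m \<Longrightarrow> n \<ge> 1 \<Longrightarrow> twist n v \<in> filt (m - n + 1)"
proof (induction rule: filt_induct)
  case (step c ks q u)
  have "twist n (lower ks (zpoly q w)) - lead n ks (zpoly q w) \<in> filt (m - n + 1)"
    by (rule filt_mono[OF _ twist_lower]) (use step in simp_all)
  moreover have "lead n ks (zpoly q w) \<in> filt (m - n + 1)"
    by (rule filt_mono[OF _ lead_filt]) (use step in simp_all)
  ultimately have "twist n (lower ks (zpoly q w)) \<in> filt (m - n + 1)"
    using filt_simps(2) by fastforce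
  with step show ?case by (simp add: twist_linear filt_simps)
qed (simp add: twist_linear filt_simps)

text \<open>
  To leading order \<open>twists ls\<close> is a multiple of the product of the \<open>\<partial>/\<partial>x\<^sub>l\<close> with \<open>l\<close> in \<open>ls\<close>.
\<close>

definition twists :: "nat list \<Rightarrow> 'v \<Rightarrow> 'v" where
  "twists = fold (\<lambda>l. twist (int l + 2))"

lemma twists_simps [simp]:
  "twists [] v = v"
  "twists (l # ls) v = twists ls (twist (int l + 2) v)"
  by (simp_all add: twists_def)

lemma twists_linear:
  "twists ls (u + v) = twists ls u + twists ls v"
  "twists ls (scale c v) = scale c (twists ls v)"
  "twists ls 0 = 0"
  by (induction ls arbitrary: u v) (simp_all add: twist_linear)

lemma twists_sum: "twists ls (sum f A) = (\<Sum>i\<in>A. twists ls (f i))"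
  by (induction A rule: infinite_finite_induct) (simp_all add: twists_linear)

lemma twists_in_submodule: "submodule N \<Longrightarrow> v \<in> N \<Longrightarrow> twists ls v \<in> N"
  by (induction ls arbitrary: v) (simp_all add: twist_def submoduleD)

lemma twists_filt: "v \<in> filt m \<Longrightarrow> twists ls v \<in> filt (m - weight ls)"
proof (induction ls arbitrary: v m)
  case (Cons l ls)
  from Cons.IH[OF twist_filt[OF Cons.prems, of "int l + 2"]] show ?case
    by (simp add: algebra_simps)
qed simp

text \<open>
  The error term of \<open>twist_lower\<close> is too light to survive the remaining operators, each of which
  lowers the weight by \<open>l + 1\<close>. So here the leading term is the exact result.
\<close>

lemma twists_Cons_lower:
  assumes "weight ks \<le> weight (l # ls)"
  shows "twists (l # ls) (lower ks (zpoly q w)) =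
    scale (- (2 * of_nat l + 2) * \<psi> (vir_d 2) * of_nat (count (mset ks) l))
      (twists ls (lower (remove1 l ks) (zpoly q w)))"
proof -
  let ?u = "zpoly q w" and ?n = "int l + 2"
  let ?g = "twist ?n (lower ks ?u) - lead ?n ks ?u"
  have "twists ls ?g \<in> filt (weight ks - ?n + 1 - weight ls)"
    by (rule twists_filt, rule twist_lower) simp
  then have "twists ls ?g = 0" by (rule filt_nonpos) (use assms in simp)
  then have "twists ls (twist ?n (lower ks ?u)) = twists ls (lead ?n ks ?u)"
    using twists_linear(1)[of ls ?g "lead ?n ks ?u"] by simp
  then show ?thesis by (simp add: lead_def twists_linear)
qed

text \<open>
  A product of partial derivatives kills every monomial that does not contain it as a factor, and a
  monomial that does contain it but is no heavier is equal to it.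
\<close>

lemma twists_lower_other:
  "weight ks \<le> weight ls \<Longrightarrow> mset ks \<noteq> mset ls \<Longrightarrow> twists ls (lower ks (zpoly q w)) = 0"
proof (induction ls arbitrary: ks)
  case Nil
  then show ?case by (simp add: weight_le_0_iff)
next
  case (Cons l ls)
  show ?case
  proof (cases "l \<in> set ks")
    case True
    have "mset (remove1 l ks) \<noteq> mset ls"
      using Cons.prems(2) True by (metis insert_DiffM mset.simps(2) mset_remove1 set_mset_mset)
    then have "twists ls (lower (remove1 l ks) (zpoly q w)) = 0"
      using Cons.prems(1) by (intro Cons.IH) (simp_all add: weight_remove1[OF True])
    then show ?thesis by (simp only: twists_Cons_lower[OF Cons.prems(1)] scale_zero_right)
  next
    case False
    then have "count (mset ks) l = 0" by (simp add: not_in_iff[symmetric])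
    then show ?thesis by (simp add: twists_Cons_lower[OF Cons.prems(1)] del: twists_simps)
  qed
qed

text \<open>
  The product of derivatives \<open>\<partial>\<^sup>\<lambda>\<close> sends \<open>x\<^sup>\<lambda>\<close> to \<open>\<lambda>!\<close>; here \<open>c\<close> is \<open>\<lambda>!\<close> times the factors
  \<open>- (2 l + 2) \<psi>(d\<^sub>2)\<close>.
\<close>

lemma twists_lower_self: "\<exists>c. c \<noteq> 0 \<and> (\<forall>q. twists ls (lower ls (zpoly q w)) = scale c (zpoly q w))"
proof (induction ls)
  case Nil
  show ?case by (auto intro: exI[of _ 1])
next
  case (Cons l ls)
  then obtain c where c: "c \<noteq> 0" "\<And>q. twists ls (lower ls (zpoly q w)) = scale c (zpoly q w)"
    by blast
  let ?b = "- (2 * of_nat l + 2) * \<psi> (vir_d 2) * of_nat (Suc (count (mset ls) l))"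
  have "(2 * of_nat l + 2 :: complex) = of_nat (2 * l + 2)" by simp
  then have "(2 * of_nat l + 2 :: complex) \<noteq> 0" by (metis of_nat_eq_0_iff add_is_0 zero_neq_numeral)
  then have "?b \<noteq> 0" using psi_2 by (simp only: mult_eq_0_iff neg_equal_0_iff_equal of_nat_eq_0_iff) simp
  moreover have "twists (l # ls) (lower (l # ls) (zpoly q w)) = scale (?b * c) (zpoly q w)" for q
    by (subst twists_Cons_lower) (simp_all add: c(2))
  ultimately show ?case using c(1) by (intro exI[of _ "?b * c"] conjI allI) simp_all
qed

text \<open>
  Induction that removes a monomial \<open>ls\<close> of greatest weight: \<open>twists ls\<close> isolates its coefficient,
  and \<open>N\<close> is stable under \<open>twists ls\<close>. With \<open>N = {0}\<close> this is the linear independence of the monomials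
  over the polynomials in \<open>z\<close> modulo the annihilator of \<open>w\<close>.
\<close>

lemma coefficients_in_submodule:
  assumes N: "submodule N"
    and "finite A" "inj_on mset A"
    and "(\<Sum>ks\<in>A. lower ks (zpoly (P ks) w)) \<in> N"
    and "ks \<in> A"
  shows "zpoly (P ks) w \<in> N"
  using assms(2-)
proof (induction A arbitrary: ks rule: finite_ranking_induct[where f = weight])
  case empty
  then show ?case by simp
next
  case (insert ls A)
  show ?case
  proof (cases "ls \<in> A")
    case True
    with insert show ?thesis by (simp add: insert_absorb)
  next
    case False
    let ?f = "\<lambda>ks. lower ks (zpoly (P ks) w)"
    have sum: "sum ?f (insert ls A) = ?f ls + sum ?f A"
      using False insert.hyps by simp
    obtain c where c: "c \<noteq> 0" "twists ls (?f ls) = scale c (zpoly (P ls) w)"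
      using twists_lower_self by blast
    have "twists ls (?f ks) = 0" if "ks \<in> A" for ks
      using that False insert.hyps(2)[OF that] insert.prems(1)
      by (intro twists_lower_other) (auto simp: inj_on_def)
    then have "twists ls (sum ?f A) = 0" by (simp add: twists_sum)
    then have "scale c (zpoly (P ls) w) \<in> N"
      using twists_in_submodule[OF N insert.prems(2), of ls]
      by (simp only: sum twists_linear c(2) add_0_right)
    then have "scale (1 / c) (scale c (zpoly (P ls) w)) \<in> N"
      by (rule submoduleD(3)[OF N])
    then have ls: "zpoly (P ls) w \<in> N" using c(1) by simp
    have "sum ?f A \<in> N"
      using submoduleD(4)[OF N insert.prems(2) lower_in_submodule[OF N ls, of ls]] sum by simp
    with insert ls show ?thesis by auto
  qed
qed

section \<open>Normal forms\<close>

text \<open>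
  The union of the filtration contains \<open>w\<close> and is a submodule: a lowering operator \<open>d\<^sub>-\<^sub>k\<close> raises the
  bound by \<open>k + 1\<close>, and \<open>twist_filt\<close> takes care of \<open>d\<^sub>n\<close> for \<open>n \<ge> 1\<close>.
\<close>

lemma filt_exhaustive: "\<exists>m. v \<in> filt m"
proof -
  let ?S = "{v. \<exists>m. v \<in> filt m}"
  have add: "x + y \<in> ?S" if x: "x \<in> ?S" and y: "y \<in> ?S" for x y
  proof -
    obtain m n where "x \<in> filt m" "y \<in> filt n" using x y by blast
    then have "x \<in> filt (max m n)" "y \<in> filt (max m n)" by (auto elim!: filt_mono[rotated])
    then show ?thesis by (auto intro: filt_simps(2))
  qed
  have z: "act vir_z v \<in> filt m" if "v \<in> filt m" for v m
    using that
    by (induction rule: filt_induct) (auto simp: act_z_lower intro!: filt_simps intro: filt_base)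
  have "act x v \<in> ?S" if v: "v \<in> ?S" for x v
  proof (induction x rule: vir_basis_induct)
    case (5 k)
    obtain m where m: "v \<in> filt m" using v by blast
    show ?case
    proof (cases "k \<le> 0")
      case True
      then have "k = - int (nat (- k))" by simp
      then show ?thesis using act_lower_filt[OF m, of "nat (- k)"] by auto
    next
      case False
      then have "twist k v \<in> ?S" using twist_filt[OF m, of k] by auto
      moreover have "scale (\<psi> (vir_d k)) v \<in> ?S" using m filt_simps(3) by blast
      ultimately show ?thesis unfolding act_twist by (rule add[rotated])
    qed
  next
    case (2 x y)
    then show ?case using add by (simp only: act_left_simps)
  next
    case (3 c x)
    then show ?case using filt_simps(3) unfolding act_left_simps by blast
  next
    case 4
    show ?case using v z by blast
  qed (use filt_simps(1) in \<open>auto simp: act_left_simps\<close>)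
  moreover have "scale c x \<in> ?S" if "x \<in> ?S" for c x
    using that filt_simps(3) by blast
  moreover have "0 \<in> ?S" using filt_simps(1) by blast
  ultimately have "submodule ?S"
    using add by (simp add: submodule_def subspace_def)
  moreover have "w \<in> ?S" using filt_base[of "[]" 1 1] by auto
  ultimately show ?thesis using gen_minimal[of ?S w] gen_w by blast
qed

text \<open>
  Sorted lists serve as representatives of multisets.
\<close>

definition normal_form :: "'v \<Rightarrow> nat list set \<Rightarrow> (nat list \<Rightarrow> complex poly) \<Rightarrow> bool" where
  "normal_form v A P \<longleftrightarrow> finite A \<and> (\<forall>ks\<in>A. sorted ks) \<and> v = (\<Sum>ks\<in>A. lower ks (zpoly (P ks) w))"

lemma normal_form_inj: "normal_form v A P \<Longrightarrow> inj_on mset A"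
proof (rule inj_onI)
  fix ks ls assume "normal_form v A P" "ks \<in> A" "ls \<in> A" and "mset ks = mset ls"
  then have "sorted ks" "sorted ls" by (simp_all add: normal_form_def)
  with \<open>mset ks = mset ls\<close> show "ks = ls" by (metis properties_for_sort)
qed

lemma normal_form_extend:
  assumes "normal_form v A P" "A \<subseteq> B" "finite B"
  shows "v = (\<Sum>ks\<in>B. lower ks (zpoly (if ks \<in> A then P ks else 0) w))"
proof -
  have "v = (\<Sum>ks\<in>A. lower ks (zpoly (P ks) w))"
    using assms(1) by (simp only: normal_form_def)
  also have "\<dots> = (\<Sum>ks\<in>B. lower ks (zpoly (if ks \<in> A then P ks else 0) w))"
    by (rule sum.mono_neutral_cong_left[OF assms(3,2)]) (simp_all add: lower_linear)
  finally show ?thesis .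
qed

lemma normal_form_add:
  assumes "normal_form u A P" "normal_form v B Q"
  shows "\<exists>C R. normal_form (u + v) C R"
proof -
  let ?P = "\<lambda>ks. if ks \<in> A then P ks else 0" and ?Q = "\<lambda>ks. if ks \<in> B then Q ks else 0"
  have C: "finite (A \<union> B)" "\<forall>ks\<in>A \<union> B. sorted ks"
    using assms unfolding normal_form_def by auto
  have "u + v = (\<Sum>ks\<in>A \<union> B. lower ks (zpoly (?P ks) w)) + (\<Sum>ks\<in>A \<union> B. lower ks (zpoly (?Q ks) w))"
    using normal_form_extend[OF assms(1) Un_upper1 C(1)] normal_form_extend[OF assms(2) Un_upper2 C(1)]
    by (rule arg_cong2)
  also have "\<dots> = (\<Sum>ks\<in>A \<union> B. lower ks (zpoly (?P ks + ?Q ks) w))"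
    by (simp only: zpoly_add lower_linear sum.distrib)
  finally have "normal_form (u + v) (A \<union> B) (\<lambda>ks. ?P ks + ?Q ks)"
    unfolding normal_form_def using C by (intro conjI)
  then show ?thesis by blast
qed

text \<open>
  Sorting a monomial changes it by terms of lower weight, which are covered by induction.
\<close>

lemma normal_form_filt: "v \<in> filt (int m) \<Longrightarrow> \<exists>A P. normal_form v A P"
proof (induction m arbitrary: v)
  case 0
  then have "v = 0" by (simp add: filt_nonpos)
  then have "normal_form v {} undefined" by (simp add: normal_form_def)
  then show ?case by blast
next
  case (Suc m)
  from Suc.prems show ?case
  proof (induction rule: filt_induct)
    case zero
    have "normal_form 0 {} undefined" by (simp add: normal_form_def)
    then show ?case by blast
  next
    case (step c ks q u)
    let ?g = "lower ks (zpoly q w) - lower (sort ks) (zpoly q w)"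
    have "?g \<in> filt (weight ks)" by (rule lower_perm) simp
    then have "scale c ?g \<in> filt (int m)"
      by (intro filt_simps(3)) (rule filt_mono, use step in simp_all)
    then obtain A P where 1: "normal_form (scale c ?g) A P" using Suc.IH by blast
    have 2: "normal_form (scale c (lower (sort ks) (zpoly q w))) {sort ks} (\<lambda>_. smult c q)"
      by (simp add: normal_form_def zpoly_smult lower_linear)
    obtain B Q where 3: "normal_form u B Q" using step by blast
    have "scale c (lower ks (zpoly q w)) = scale c ?g + scale c (lower (sort ks) (zpoly q w))"
      by (simp add: scale_right_diff_distrib)
    then obtain C R where "normal_form (scale c (lower ks (zpoly q w))) C R"
      using normal_form_add[OF 1 2] by auto
    from normal_form_add[OF this 3] show ?case .
  qed
qed

lemma normal_form_exists: "\<exists>A P. normal_form v A P"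
proof -
  obtain m where "v \<in> filt m" using filt_exhaustive by blast
  then have "v \<in> filt (int (nat m))" by (rule filt_mono[rotated]) simp
  then show ?thesis by (rule normal_form_filt)
qed

section \<open>Classification of submodules\<close>

lemma submodule_range_zpoly: "submodule (range (zpoly q))"
  by (rule submodule_zpoly_image) (simp add: submodule_def)

lemma gen_zpoly_w: "gen (zpoly q w) = range (zpoly q)"
  by (simp add: gen_zpoly gen_w)

text \<open>
  By \<open>coefficients_in_submodule\<close>, all coefficients in the normal form of an element of \<open>N\<close> are
  divisible by the generator \<open>g\<close> of the ideal of polynomials that carry \<open>w\<close> into \<open>N\<close>, and \<open>g\<close> can be
  pulled out of the sum.
\<close>

lemma submodule_principal:
  assumes N: "submodule N"
  obtains g where "\<And>q. zpoly q w \<in> N \<longleftrightarrow> g dvd q" "N = range (zpoly g)"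
proof -
  let ?I = "{q. zpoly q w \<in> N}"
  have "\<exists>g. \<forall>q. q \<in> ?I \<longleftrightarrow> g dvd q"
    by (rule poly_ideal_principal)
      (simp_all add: zpoly_diff zpoly_mult submoduleD[OF N] zpoly_in_submodule[OF N])
  then obtain g where g: "\<And>q. zpoly q w \<in> N \<longleftrightarrow> g dvd q" by auto
  have "v \<in> range (zpoly g)" if v: "v \<in> N" for v
  proof -
    obtain A P where AP: "normal_form v A P" using normal_form_exists by blast
    have "g dvd P ks" if "ks \<in> A" for ks
      using coefficients_in_submodule[OF N _ normal_form_inj[OF AP] _ that, of P] AP v
      by (auto simp: normal_form_def g)
    then have "P ks = g * (P ks div g)" if "ks \<in> A" for ks
      using that by simp
    then have "v = (\<Sum>ks\<in>A. lower ks (zpoly (g * (P ks div g)) w))"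
      using AP by (simp add: normal_form_def)
    also have "\<dots> = zpoly g (\<Sum>ks\<in>A. lower ks (zpoly (P ks div g) w))"
      by (simp add: zpoly_mult lower_zpoly zpoly_sum)
    finally show ?thesis by blast
  qed
  then have "N \<subseteq> range (zpoly g)" by (rule subsetI)
  moreover have "range (zpoly g) \<subseteq> N"
    using gen_minimal[OF N, of "zpoly g w"] by (simp add: gen_zpoly_w g)
  ultimately have "N = range (zpoly g)" by (rule equalityI)
  with g show ?thesis by (rule that)
qed

lemma zpoly_range_mono: "h dvd g \<Longrightarrow> range (zpoly g) \<subseteq> range (zpoly h)"
  by (auto elim!: dvdE simp: zpoly_mult)

text \<open>
  If \<open>g(z) w = h(z) v\<close>, write \<open>v\<close> in normal form and compare the coefficients of the empty monomial:
  \<open>g\<close> is congruent to a multiple of \<open>h\<close> modulo \<open>p\<close>. As \<open>h\<close> divides \<open>p\<close>, it divides \<open>g\<close>.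
\<close>

lemma range_zpoly_subset_iff:
  assumes ann: "\<And>r. zpoly r w = 0 \<longleftrightarrow> p dvd r" and h: "h dvd p"
  shows "range (zpoly g) \<subseteq> range (zpoly h) \<longleftrightarrow> h dvd g"
proof
  assume "range (zpoly g) \<subseteq> range (zpoly h)"
  then obtain v where v: "zpoly g w = zpoly h v" by blast
  obtain A P where AP: "normal_form v A P" using normal_form_exists by blast
  \<comment> \<open>The empty monomial may be missing from \<open>A\<close>; it is added with coefficient \<open>0\<close>.\<close>
  let ?P = "\<lambda>ks. if ks \<in> A then P ks else 0" and ?A = "insert [] A"
  let ?Q = "\<lambda>ks. h * ?P ks - (if ks = [] then g else 0)"
  have fin: "finite ?A" using AP by (simp add: normal_form_def)
  have "v = (\<Sum>ks\<in>?A. lower ks (zpoly (?P ks) w))"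
    by (rule normal_form_extend[OF AP subset_insertI fin])
  then have "zpoly h v = (\<Sum>ks\<in>?A. lower ks (zpoly (h * ?P ks) w))"
    by (simp only: zpoly_sum zpoly_mult lower_zpoly)
  moreover have "zpoly g w = (\<Sum>ks\<in>?A. lower ks (zpoly (if ks = [] then g else 0) w))"
  proof -
    have "(\<Sum>ks\<in>?A. lower ks (zpoly (if ks = [] then g else 0) w)) =
        (\<Sum>ks\<in>?A. if ks = [] then zpoly g w else 0)"
      by (intro sum.cong) (simp_all add: lower_linear)
    also have "\<dots> = zpoly g w" using fin by (subst sum.delta) simp_all
    finally show ?thesis by simp
  qed
  ultimately have "(\<Sum>ks\<in>?A. lower ks (zpoly (?Q ks) w)) = 0"
    using v by (simp only: zpoly_diff lower_linear sum_subtractf) simp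
  moreover from this have "normal_form 0 ?A ?Q" using AP by (simp add: normal_form_def)
  ultimately have "zpoly (?Q []) w \<in> {0}"
    by (intro coefficients_in_submodule[OF submodule_zero, of ?A ?Q "[]"] normal_form_inj fin) simp_all
  then have "p dvd h * ?P [] - g" by (simp add: ann)
  then have "h dvd h * ?P [] - g" using h by (rule dvd_trans[rotated])
  then show "h dvd g" by (simp add: dvd_diff_right_iff)
qed (rule zpoly_range_mono)

text \<open>
  A submodule of \<open>q(z) V\<close> is \<open>g(z) V\<close> with \<open>q\<close> dividing \<open>g\<close> and \<open>g\<close> dividing \<open>p\<close>, so \<open>g\<close> is \<open>q\<close> times a
  power of the linear polynomial, up to a unit. The exponent is counted from \<open>n\<close> downwards to
  make the chain ascending.
\<close>

lemma submodules_of_primary_part: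
  assumes ann: "\<And>r. zpoly r w = 0 \<longleftrightarrow> p dvd r"
    and p: "p = q * [:- x, 1:] ^ n" "p \<noteq> 0"
  shows "submodule N \<and> N \<subseteq> range (zpoly q) \<longleftrightarrow>
      (\<exists>i\<le>n. N = range (zpoly (q * [:- x, 1:] ^ (n - i))))"
    and "i \<le> n \<Longrightarrow> j \<le> n \<Longrightarrow> range (zpoly (q * [:- x, 1:] ^ (n - i))) \<subseteq>
      range (zpoly (q * [:- x, 1:] ^ (n - j))) \<longleftrightarrow> i \<le> j"
proof -
  have q: "q \<noteq> 0" "q dvd p" using p by auto
  show "submodule N \<and> N \<subseteq> range (zpoly q) \<longleftrightarrow>
      (\<exists>i\<le>n. N = range (zpoly (q * [:- x, 1:] ^ (n - i))))" (is "?L \<longleftrightarrow> ?R")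
  proof
    assume L: ?L
    then obtain g where g: "\<And>r. zpoly r w \<in> N \<longleftrightarrow> g dvd r" "N = range (zpoly g)"
      using submodule_principal[of N] by blast
    have "zpoly p w = 0" by (simp add: ann)
    then have "g dvd p" using L g(1)[of p] submoduleD(1)[of N] by simp
    have "q dvd g" using L range_zpoly_subset_iff[OF ann q(2)] g(2) by blast
    then obtain h where h: "g = q * h" by blast
    with \<open>g dvd p\<close> have "h dvd [:- x, 1:] ^ n" using p q by simp
    then obtain i where i: "i \<le> n" "normalize h = normalize ([:- x, 1:] ^ i)"
      using divides_linear_power by blast
    have "range (zpoly g) = range (zpoly (q * [:- x, 1:] ^ i))"
      unfolding h using associatedD1[OF i(2)] associatedD2[OF i(2)]
      by (intro equalityI zpoly_range_mono mult_dvd_mono) simp_all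
    then show ?R using i(1) g(2) by (intro exI[of _ "n - i"]) simp
  next
    assume ?R
    then obtain i where "N = range (zpoly (q * [:- x, 1:] ^ (n - i)))" by blast
    then show ?L using submodule_range_zpoly zpoly_range_mono[OF dvd_triv_left] by (simp only:)
  qed
  assume ij: "i \<le> n" "j \<le> n"
  have "q * [:- x, 1:] ^ (n - j) dvd p"
    unfolding p by (intro mult_dvd_mono le_imp_power_dvd) simp_all
  from range_zpoly_subset_iff[OF ann this]
  show "range (zpoly (q * [:- x, 1:] ^ (n - i))) \<subseteq>
      range (zpoly (q * [:- x, 1:] ^ (n - j))) \<longleftrightarrow> i \<le> j"
    using ij q by (auto simp: linear_power_dvd_iff)
qed

section \<open>Primary decomposition\<close>

lemma direct_sum_cong:
  assumes "\<And>i. i \<in> I \<Longrightarrow> M i = N i"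
  shows "direct_sum U I M \<longleftrightarrow> direct_sum U I N"
proof -
  have "(\<forall>i\<in>I. f i \<in> M i) \<longleftrightarrow> (\<forall>i\<in>I. f i \<in> N i)" for f
    using assms by blast
  moreover have "(\<forall>i\<in>I. submodule (M i)) \<longleftrightarrow> (\<forall>i\<in>I. submodule (N i))"
    using assms by simp
  ultimately show ?thesis unfolding direct_sum_def by (simp only:)
qed

text \<open>
  A partition of unity shows that the submodules span. For a relation \<open>\<Sum>\<^sub>i f\<^sub>i = 0\<close>, the component
  \<open>f\<^sub>j\<close> is killed by \<open>q\<^sub>j\<close>, because the product of all \<open>q\<^sub>i\<close> acts as zero. It is also killed by the
  cofactor of \<open>q\<^sub>j\<close>, because this cofactor kills the whole sum and every other summand. The two
  polynomials are coprime, so \<open>f\<^sub>j = 0\<close>.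
\<close>

lemma direct_sum_coprime_parts:
  assumes ann: "zpoly (\<Prod>i\<in>I. q i) w = 0" and "finite I"
    and cop: "\<And>i j. i \<in> I \<Longrightarrow> j \<in> I \<Longrightarrow> i \<noteq> j \<Longrightarrow> coprime (q i) (q j)"
  shows "direct_sum UNIV I (\<lambda>j. range (zpoly (\<Prod>i\<in>I - {j}. q i)))"
proof -
  let ?p = "\<Prod>i\<in>I. q i" and ?c = "\<lambda>j. \<Prod>i\<in>I - {j}. q i"
  have killed: "zpoly r v = 0" if r: "?p dvd r" for r v
  proof -
    obtain s where s: "r = ?p * s" using r by (elim dvdE)
    have "zpoly r w = zpoly s (zpoly ?p w)"
      unfolding s mult.commute[of ?p] by (rule zpoly_mult)
    then have "zpoly r w \<in> {0}" by (simp add: ann)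
    then have "gen (zpoly r w) \<subseteq> {0}" by (rule gen_minimal[OF submodule_zero])
    then show ?thesis by (auto simp: gen_zpoly_w)
  qed
  obtain r where r: "?p dvd 1 - (\<Sum>j\<in>I. r j * ?c j)"
    using partition_of_unity[of I q] \<open>finite I\<close> cop by blast
  have "\<exists>f. v = sum f I \<and> (\<forall>i\<in>I. f i \<in> range (zpoly (?c i)))" for v
  proof -
    have "zpoly (1 - (\<Sum>j\<in>I. r j * ?c j)) v = 0" using r by (rule killed)
    then have "v = (\<Sum>j\<in>I. zpoly (?c j) (zpoly (r j) v))"
      by (simp add: zpoly_diff zpoly_sum_left mult.commute[of "r _"] zpoly_mult)
    then show ?thesis by (intro exI[of _ "\<lambda>j. zpoly (?c j) (zpoly (r j) v)"]) simp
  qed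
  then have span: "UNIV = {sum f I |f. \<forall>i\<in>I. f i \<in> range (zpoly (?c i))}"
    by (intro equalityI subsetI CollectI UNIV_I)
  have independent: "\<forall>i\<in>I. f i = 0" if f: "\<forall>i\<in>I. f i \<in> range (zpoly (?c i))" "sum f I = 0" for f
  proof
    fix j assume j: "j \<in> I"
    have p: "?p = q i * ?c i" if "i \<in> I" for i
      using that \<open>finite I\<close> by (rule prod.remove[rotated])
    have q0: "zpoly (q i) (f i) = 0" if i: "i \<in> I" for i
    proof -
      obtain v where "f i = zpoly (?c i) v" using f(1) i by blast
      then have "zpoly (q i) (f i) = zpoly ?p v" by (simp add: p[OF i] zpoly_mult)
      then show ?thesis by (simp add: killed)
    qed
    have c0: "zpoly (?c j) (f i) = 0" if i: "i \<in> I" "i \<noteq> j" for i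
    proof -
      have "q i dvd ?c j" using i \<open>finite I\<close> by (intro dvd_prodI) auto
      then obtain s where "?c j = q i * s" by (elim dvdE)
      then have "zpoly (?c j) (f i) = zpoly s (zpoly (q i) (f i))"
        by (simp add: mult.commute[of "q i"] zpoly_mult)
      then show ?thesis using q0[OF i(1)] by simp
    qed
    have "0 = zpoly (?c j) (sum f I)" by (simp add: f(2))
    also have "\<dots> = zpoly (?c j) (f j) + (\<Sum>i\<in>I - {j}. zpoly (?c j) (f i))"
      unfolding zpoly_sum by (rule sum.remove[OF \<open>finite I\<close> j])
    also have "(\<Sum>i\<in>I - {j}. zpoly (?c j) (f i)) = 0" by (simp add: c0)
    finally have "zpoly (?c j) (f j) = 0" by simp
    have "coprime (q j) (?c j)" using cop j by (intro prod_coprime_right) auto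
    then have "gcd (q j) (?c j) = 1" by (rule coprime_imp_gcd_eq_1)
    then obtain s t where "s * q j + t * ?c j = 1"
      using bezout_coefficients_fst_snd[of "q j" "?c j"] by (simp only:)
    then have "f j = zpoly (s * q j + t * ?c j) (f j)" by simp
    also have "\<dots> = 0"
      using q0[OF j] \<open>zpoly (?c j) (f j) = 0\<close> by (simp add: zpoly_add zpoly_mult)
    finally show "f j = 0" .
  qed
  show ?thesis
    unfolding direct_sum_def
  proof (intro conjI allI impI)
    fix f assume "(\<forall>i\<in>I. f i \<in> range (zpoly (?c i))) \<and> sum f I = 0"
    then show "\<forall>i\<in>I. f i = 0" by (elim conjE independent)
  qed (use \<open>finite I\<close> submodule_range_zpoly span in simp_all)
qed

end

theorem theorem5p2:
  fixes scale :: "complex \<Rightarrow> 'v::ab_group_add \<Rightarrow> 'v"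
    and act :: "virasoro \<Rightarrow> 'v \<Rightarrow> 'v"
    and \<psi> :: "virasoro \<Rightarrow> complex"
    and w :: 'v
    and p :: "complex poly"
    and k :: nat
    and \<xi> :: "nat \<Rightarrow> complex"
    and a :: "nat \<Rightarrow> nat"
    and ps :: "nat \<Rightarrow> complex poly"
    and ws :: "nat \<Rightarrow> 'v"
    and Vs :: "nat \<Rightarrow> 'v set"
  assumes "virasoro_module scale act"
    and "lie_hom_n_plus \<psi>"
    and "\<psi> (vir_d 1) \<noteq> 0"
    and "\<psi> (vir_d 2) \<noteq> 0"
    and "virasoro_module.whittaker_module scale act \<psi> UNIV w"
    and "virasoro_module.z_ann scale act w \<noteq> {0}"
    and "monic_generator p (virasoro_module.z_ann scale act w)"
    and "p = (\<Prod>i\<in>{1..k}. [:- \<xi> i, 1:] ^ a i)"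
    and "inj_on \<xi> {1..k}"
    and "\<And>i. i \<in> {1..k} \<Longrightarrow> a i > 0"
    and "\<And>j. j \<in> {1..k} \<Longrightarrow> ps j = (\<Prod>i\<in>{1..k} - {j}. [:- \<xi> i, 1:] ^ a i)"
    and "\<And>j. j \<in> {1..k} \<Longrightarrow> ws j = virasoro_module.zpoly scale act (ps j) w"
    and "\<And>j. j \<in> {1..k} \<Longrightarrow> Vs j = virasoro_module.gen scale act (ws j)"
  shows "(\<forall>j\<in>{1..k}. virasoro_module.whittaker_module scale act \<psi> (Vs j) (ws j)) \<and>
    virasoro_module.direct_sum scale act UNIV {1..k} Vs \<and>
    (\<forall>j\<in>{1..k}. virasoro_module.indecomposable scale act (Vs j)) \<and>
    (\<forall>j\<in>{1..k}. virasoro_module.simple scale act (Vs j) \<longleftrightarrow> a j = 1) \<and>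
    (\<forall>j\<in>{1..k}. virasoro_module.composition_length scale act (Vs j) (a j))"
proof -
  interpret virasoro_module scale act by (rule assms(1))
  have w: "whittaker_vector \<psi> w" "gen w = UNIV"
    using assms(5) by (simp_all add: whittaker_module_def)
  interpret whittaker_cyclic scale act \<psi> w
    by standard (use assms(2,4) w in auto)
  have ann: "zpoly r w = 0 \<longleftrightarrow> p dvd r" for r
    using assms(7) by (auto simp: monic_generator_def z_ann_def)
  have p0: "p \<noteq> 0" using assms(7) by (auto simp: monic_generator_def)
  have ws: "ws j = zpoly (ps j) w" and Vs: "Vs j = range (zpoly (ps j))" if "j \<in> {1..k}" for j
    using assms(12,13)[OF that] by (simp_all add: gen_zpoly_w)
  have p: "p = ps j * [:- \<xi> j, 1:] ^ a j" if "j \<in> {1..k}" for j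
    using that unfolding assms(8) assms(11)[OF that] by (subst prod.remove[of _ j]) simp_all
  have uniserial: "uniserial scale act (Vs j) (a j)
      (\<lambda>i. range (zpoly (ps j * [:- \<xi> j, 1:] ^ (a j - i))))" if j: "j \<in> {1..k}" for j
  proof
    show "submodule N \<and> N \<subseteq> Vs j \<longleftrightarrow>
        (\<exists>i\<le>a j. N = range (zpoly (ps j * [:- \<xi> j, 1:] ^ (a j - i))))" for N
      unfolding Vs[OF j] by (rule submodules_of_primary_part(1)[OF ann p[OF j] p0])
    show "submodule (Vs j)"
      unfolding Vs[OF j] by (rule submodule_range_zpoly)
  qed (rule submodules_of_primary_part(2)[OF ann p[OF j] p0])
  have "coprime ([:- \<xi> i, 1:] ^ a i) ([:- \<xi> j, 1:] ^ a j)"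
    if "i \<in> {1..k}" "j \<in> {1..k}" "i \<noteq> j" for i j
    using that inj_onD[OF assms(9)] by (intro coprime_linear_powers) blast
  moreover have "zpoly (\<Prod>i\<in>{1..k}. [:- \<xi> i, 1:] ^ a i) w = 0"
    unfolding assms(8)[symmetric] by (simp only: ann dvd_refl)
  ultimately have "direct_sum UNIV {1..k} (\<lambda>j. range (zpoly (\<Prod>i\<in>{1..k} - {j}. [:- \<xi> i, 1:] ^ a i)))"
    by (intro direct_sum_coprime_parts) simp_all
  moreover have "Vs j = range (zpoly (\<Prod>i\<in>{1..k} - {j}. [:- \<xi> i, 1:] ^ a i))" if "j \<in> {1..k}" for j
    unfolding Vs[OF that] assms(11)[OF that] ..
  ultimately have "direct_sum UNIV {1..k} Vs"
    by (subst direct_sum_cong)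
  moreover have "whittaker_module \<psi> (Vs j) (ws j)" if "j \<in> {1..k}" for j
    unfolding whittaker_module_def assms(13)[OF that]
    by (intro conjI submodule_gen gen_self refl) (unfold ws[OF that], rule whittaker_vector_zpoly[OF w(1)])
  ultimately show ?thesis
    using uniserial.indecomposable[OF uniserial assms(10)] uniserial.simple_iff[OF uniserial]
      uniserial.composition_length[OF uniserial]
    by (intro conjI ballI)
qed

end
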